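(* Let $A\in\mathbb{R}^{m\times n}$ with $m\ge n$ and $b\in\mathbb{R}^m$. Let $\sigma_n$ be the smallest singular value of $A$ and $\widetilde{\sigma}_{n+1}$ the smallest singular value of $[A,b]$, and assume $\widetilde{\sigma}_{n+1}<\sigma_n$. Let $\widetilde{M}=A^TA-\widetilde{\sigma}_{n+1}^2I_n$, let $x=x(A,b)=\widetilde{M}^{-1}A^Tb$ be the total least squares solution, $r=b-Ax$, let $L\in\mathbb{R}^{n\times k}$ ($k\le n$) be fixed, and set $$D_\sigma=L^T\widetilde{M}^{-1}\left(A^T+\frac{2xr^T}{1+\|x\|_2^2}\right).$$ Let $\Psi\in\mathbb{R}^{m\times n}$, $\beta\in\mathbb{R}^m$, $\xi\in\mathbb{R}^k$ be parameters. Then the partial unified condition number of the total least squares problem with respect to $L$ (defined in the context) is $$\kappa_{TLS}(A,b)=\left\|\mathrm{diag}^{\ddag}(\xi)\left[\left(r^T\otimes(L^T\widetilde{M}^{-1})\right)\Pi_{mn}-x^T\otimes D_\sigma,\ \ D_\sigma\right]\mathrm{diag}(\mathrm{vec}(\Psi,\beta))\right\|_{\mu,\nu},$$ where $\|\cdot\|_{\mu,\nu}$ is the matrix norm induced by the vector norms $\|\cdot\|_\mu$ on $\mathbb{R}^{mn+m}$ and $\|\cdot\|_\nu$ on $\mathbb{R}^k$. Further, if $\mu=\nu=2$ and $\Psi,\beta,\xi$ are instead positive real numbers, then the condition number is $$\kappa_{2TLS}(A,b)=\frac{\left\|\left[\Psi\left(\left(r^T\otimes(L^T\widetilde{M}^{-1})\right)\Pi_{mn}-x^T\otimes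 D_\sigma\right),\ \ \beta D_\sigma\right]\right\|_2}{\xi}.$$
   Context: The total least squares (TLS) problem is $\min_{E,\epsilon}\|[E,\epsilon]\|_F$ subject to $(A+E)x=b+\epsilon$; when $\widetilde{\sigma}_{n+1}<\sigma_n$ its unique solution is $x(A,b)=(A^TA-\widetilde{\sigma}_{n+1}^2I_n)^{-1}A^Tb$. Here $\widetilde{\sigma}_{n+1}$ depends on $(A,b)$; $\widetilde{\sigma}_{n+1}^2$ is the smallest eigenvalue of $[A,b]^T[A,b]$. Notation: for $c\in\mathbb{R}$, $c^{\ddag}=1/c$ if $c\neq 0$ and $c^{\ddag}=1$ if $c=0$. For a vector $v$, $\mathrm{diag}(v)$ is the diagonal matrix with diagonal $v$, and $\mathrm{diag}^{\ddag}(v)$ the diagonal matrix with diagonal entries $v_i^{\ddag}$. Entry-wise division of vectors is $\frac{a}{v}=\mathrm{diag}^{\ddag}(v)a$, and similarly for matrices of equal size; division by a scalar parameter is ordinary division. $\mathrm{vec}$ stacks the columns of a matrix; $\mathrm{vec}(\Psi,\beta)$ is $\mathrm{vec}(\Psi)$ stacked on top of $\beta$ (same convention for other pairs). $\otimes$ is the Kronecker product; $\Pi_{mn}$ is the vec-permutation matrix with $\Pi_{mn}\mathrm{vec}(X)=\mathrm{vec}(X^T)$ for all $X\in\mathbb{R}^{m\times n}$. $\|N\|_{\mu,\nu}=\sup_{y\neq0}\|Ny\|_\nu/\|y\|_\mu$; $\|\cdot\|_2$ is the spectral norm of a matrix or Euclidean norm of a vector. Let $g(A,b)=L^Tx(A,b)$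 with $x(A,b)$ the TLS solution, and let $g'(A,b)$ be its Fréchet derivative. The partial unified condition number is $$\kappa_{TLS}(A,b)=\sup_{\left\|\mathrm{vec}\left(\frac{\Delta A}{\Psi},\frac{\Delta b}{\beta}\right)\right\|_\mu\neq 0}\frac{\left\|\frac{g'(A,b)\circ(\Delta A,\Delta b)}{\xi}\right\|_\nu}{\left\|\mathrm{vec}\left(\frac{\Delta A}{\Psi},\frac{\Delta b}{\beta}\right)\right\|_\mu},$$ the supremum being over $\Delta A\in\mathbb{R}^{m\times n}$, $\Delta b\in\mathbb{R}^m$, with the requirement that if some entry of $\Psi$ or $\beta$ is zero, the corresponding entry of $\Delta A$ or $\Delta b$ is zero. $\kappa_{2TLS}$ denotes this quantity for $\mu=\nu=2$ and positive real $\Psi,\beta,\xi$.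
   Formalization: The first formula is proved for every norm μ if Ψ and β have no zero entry, and only for absolute norms μ (such as all Hölder norms) if zero entries occur; for arbitrary norms μ with zero entries in Ψ or β the formula can fail. *)

theory Defs
  imports "HOL-Analysis.Analysis"
begin

subsection \<open>Block matrices and singular values\<close>

definition hjoin :: "real^'a^'m \<Rightarrow> real^'b^'m \<Rightarrow> real^('a + 'b)^'m" where
  "hjoin X Y = (\<chi> i s. case s of Inl j \<Rightarrow> X $ i $ j | Inr j \<Rightarrow> Y $ i $ j)"

definition augment :: "real^'n^'m \<Rightarrow> real^'m \<Rightarrow> real^('n + 1)^'m" where
  "augment A b = hjoin A (columnvector b)"

definition is_eigenvalue :: "real^'n^'n \<Rightarrow> real \<Rightarrow> bool" where
  "is_eigenvalue X l \<longleftrightarrow> (\<exists>v. v \<noteq> 0 \<and> X *v v = l *\<^sub>R v)"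

text \<open>One singular value per column is counted: for a matrix with fewer rows than columns
  (such as \<open>[A, b]\<close> for square \<open>A\<close>) the smallest singular value is 0.\<close>

definition smallest_sv :: "real^'n^'m \<Rightarrow> real" where
  "smallest_sv X = sqrt (LEAST l. is_eigenvalue (transpose X ** X) l)"

subsection \<open>The total least squares problem\<close>

definition tls_feasible :: "real^'n^'m \<Rightarrow> real^'m \<Rightarrow> real^'n^'m \<Rightarrow> real^'m \<Rightarrow> real^'n \<Rightarrow> bool" where
  "tls_feasible A b E \<epsilon> x \<longleftrightarrow> (A + E) *v x = b + \<epsilon>"

text \<open>The library norm on \<open>real^'b^'a\<close> is the Frobenius norm.\<close>

definition is_tls_solution :: "real^'n^'m \<Rightarrow> real^'m \<Rightarrow> real^'n \<Rightarrow> bool" where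
  "is_tls_solution A b x \<longleftrightarrow>
     (\<exists>E \<epsilon>. tls_feasible A b E \<epsilon> x \<and>
        (\<forall>E' \<epsilon>' x'. tls_feasible A b E' \<epsilon>' x' \<longrightarrow> norm (augment E \<epsilon>) \<le> norm (augment E' \<epsilon>')))"

definition tls_solution :: "real^'n^'m \<Rightarrow> real^'m \<Rightarrow> real^'n" where
  "tls_solution A b = (THE x. is_tls_solution A b x)"

definition tls_g :: "real^'k^'n \<Rightarrow> (real^'n^'m) \<times> (real^'m) \<Rightarrow> real^'k" where
  "tls_g L = (\<lambda>(A, b). transpose L *v tls_solution A b)"

definition tls_deriv ::
    "real^'k^'n \<Rightarrow> real^'n^'m \<Rightarrow> real^'m \<Rightarrow> (real^'n^'m) \<times> (real^'m) \<Rightarrow> real^'k" where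
  "tls_deriv L A b = frechet_derivative (tls_g L) (at (A, b))"

subsection \<open>Vectorisation, Kronecker product, diagonal matrices\<close>

text \<open>The entries of \<open>vectorize X\<close> are indexed by (column, row): with the lexicographic order on
  pairs this stacks the columns of \<open>X\<close>. The Kronecker product uses the same pairing.\<close>

definition vectorize :: "real^'n^'m \<Rightarrow> real^('n \<times> 'm)" where
  "vectorize X = (\<chi> p. X $ snd p $ fst p)"

definition vjoin :: "real^'a \<Rightarrow> real^'b \<Rightarrow> real^('a + 'b)" where
  "vjoin u v = (\<chi> s. case s of Inl i \<Rightarrow> u $ i | Inr j \<Rightarrow> v $ j)"

definition vec_pair :: "real^'n^'m \<Rightarrow> real^'m \<Rightarrow> real^(('n \<times> 'm) + 'm)" where
  "vec_pair X v = vjoin (vectorize X) v"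

definition kron :: "real^'b^'a \<Rightarrow> real^'d^'c \<Rightarrow> real^('b \<times> 'd)^('a \<times> 'c)" where
  "kron X Y = (\<chi> p q. X $ fst p $ fst q * Y $ snd p $ snd q)"

text \<open>\<open>kron_row v Y\<close> is the Kronecker product of the row \<open>v\<^sup>T\<close> with \<open>Y\<close>, its row index
  \<open>(1, i)\<close> being identified with \<open>i\<close>.\<close>

definition kron_row :: "real^'b \<Rightarrow> real^'d^'c \<Rightarrow> real^('b \<times> 'd)^'c" where
  "kron_row v Y = (\<chi> i. kron (rowvector v :: real^'b^1) Y $ (1, i))"

definition vec_perm :: "real^('n::finite \<times> 'm::finite)^('m \<times> 'n)" where
  "vec_perm = (\<chi> p q. if q = prod.swap p then 1 else 0)"

lemma vec_perm_vectorize: "vec_perm *v vectorize X = vectorize (transpose X)"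
  by (simp add: vec_eq_iff vec_perm_def vectorize_def transpose_def matrix_vector_mult_def
      if_distrib [of "\<lambda>c. c * _"] cong: if_cong)

definition diag :: "real^'n \<Rightarrow> real^'n^'n" where
  "diag v = (\<chi> i j. if i = j then v $ i else 0)"

definition ddag :: "real \<Rightarrow> real" where
  "ddag c = (if c = 0 then 1 else 1 / c)"

definition diag_ddag :: "real^'n \<Rightarrow> real^'n^'n" where
  "diag_ddag v = diag (\<chi> i. ddag (v $ i))"

definition vdiv :: "real^'n \<Rightarrow> real^'n \<Rightarrow> real^'n" where
  "vdiv a v = diag_ddag v *v a"

definition mdiv :: "real^'n^'m \<Rightarrow> real^'n^'m \<Rightarrow> real^'n^'m" where
  "mdiv X Y = (\<chi> i j. ddag (Y $ i $ j) * X $ i $ j)"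

subsection \<open>Vector norms and induced matrix norms\<close>

definition is_norm :: "(real^'n \<Rightarrow> real) \<Rightarrow> bool" where
  "is_norm \<mu> \<longleftrightarrow> (\<forall>x. 0 \<le> \<mu> x) \<and> (\<forall>x. \<mu> x = 0 \<longleftrightarrow> x = 0) \<and>
     (\<forall>c x. \<mu> (c *\<^sub>R x) = \<bar>c\<bar> * \<mu> x) \<and> (\<forall>x y. \<mu> (x + y) \<le> \<mu> x + \<mu> y)"

text \<open>All Hoelder norms are absolute. Absoluteness matters when parameters have zero entries:
  the condition number then only tests vectors vanishing at those entries, whereas the induced
  norm tests all vectors, and the two can differ for a norm that is not absolute.\<close>

definition is_absolute :: "(real^'n \<Rightarrow> real) \<Rightarrow> bool" where
  "is_absolute \<mu> \<longleftrightarrow> (\<forall>x y. (\<forall>i. \<bar>x $ i\<bar> = \<bar>y $ i\<bar>) \<longrightarrow> \<mu> x = \<mu> y)"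

definition induced_norm ::
    "(real^'p \<Rightarrow> real) \<Rightarrow> (real^'k \<Rightarrow> real) \<Rightarrow> real^'p^'k \<Rightarrow> real" where
  "induced_norm \<mu> \<nu> N = (SUP y \<in> {y. y \<noteq> 0}. \<nu> (N *v y) / \<mu> y)"

subsection \<open>Condition numbers\<close>

text \<open>The supremum is taken in \<open>[0, \<infinity>]\<close>; it is 0 if no perturbation is admissible, that is,
  if \<open>\<Psi>\<close> and \<open>\<beta>\<close> vanish.\<close>

definition kappa_tls ::
    "(real^(('n::finite \<times> 'm::finite) + 'm) \<Rightarrow> real) \<Rightarrow> (real^'k \<Rightarrow> real) \<Rightarrow>
     real^'n^'m \<Rightarrow> real^'m \<Rightarrow> real^'k \<Rightarrow> real^'k^'n \<Rightarrow> real^'n^'m \<Rightarrow> real^'m \<Rightarrow> ennreal" where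
  "kappa_tls \<mu> \<nu> \<Psi> \<beta> \<xi> L A b =
     (SUP (\<Delta>A, \<Delta>b) \<in> {(\<Delta>A, \<Delta>b).
          (\<forall>i j. \<Psi> $ i $ j = 0 \<longrightarrow> \<Delta>A $ i $ j = 0) \<and> (\<forall>i. \<beta> $ i = 0 \<longrightarrow> \<Delta>b $ i = 0) \<and>
          \<mu> (vec_pair (mdiv \<Delta>A \<Psi>) (vdiv \<Delta>b \<beta>)) \<noteq> 0}.
        ennreal (\<nu> (vdiv (tls_deriv L A b (\<Delta>A, \<Delta>b)) \<xi>) /
                 \<mu> (vec_pair (mdiv \<Delta>A \<Psi>) (vdiv \<Delta>b \<beta>))))"

definition kappa2_tls ::
    "real \<Rightarrow> real \<Rightarrow> real \<Rightarrow> real^'k^'n \<Rightarrow> real^'n^'m \<Rightarrow> real^'m \<Rightarrow> ennreal" where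
  "kappa2_tls \<psi> \<beta> \<xi> L A b =
     (SUP (\<Delta>A, \<Delta>b) \<in> {(\<Delta>A, \<Delta>b). norm (vec_pair (\<Delta>A /\<^sub>R \<psi>) (\<Delta>b /\<^sub>R \<beta>)) \<noteq> 0}.
        ennreal (norm (tls_deriv L A b (\<Delta>A, \<Delta>b) /\<^sub>R \<xi>) /
                 norm (vec_pair (\<Delta>A /\<^sub>R \<psi>) (\<Delta>b /\<^sub>R \<beta>))))"

end

theory Submission
  imports Defs
begin

text \<open>
  Minimising over the perturbation first, the TLS solution is the minimiser of
  \<open>\<rho>(A, b, x) = \<parallel>b - A x\<parallel>\<^sup>2 / (1 + \<parallel>x\<parallel>\<^sup>2)\<close>, whose minimum is \<open>\<tau>\<^sup>2\<close>. The gap \<open>\<tau> < \<sigma>\<close> forces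
  quadratic growth away from the minimiser, uniformly near \<open>(A, b)\<close>, so the solution depends
  continuously on the data. Near \<open>(A, b)\<close> it is a zero of
  \<open>G(A, b, x) = A\<^sup>T(b - A x) + \<rho>(A, b, x) x\<close>. At a zero of \<open>G\<close> the gradient of \<open>\<rho>\<close> in \<open>x\<close> vanishes, so
  the partial derivative of \<open>G\<close> in \<open>x\<close> is \<open>-M\<close>, and implicit differentiation gives the derivative of
  the solution without differentiating \<open>\<tau>\<close>. Substituting \<open>y = vec(\<Delta>A/\<Psi>, \<Delta>b/\<beta>)\<close> turns the condition
  number into an induced norm; for vanishing parameters one erases the corresponding entries of \<open>y\<close>,
  which does not increase an absolute norm.
\<close>

subsection \<open>Minimal stretch of a linear map and singular values\<close>

lemma linear_norm_min_exists:
  fixes f :: "'a::euclidean_space \<Rightarrow> 'b::real_normed_vector"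
  assumes "linear f"
  obtains v where "norm v = 1" "\<And>w. norm (f v) * norm w \<le> norm (f w)"
proof -
  have "continuous_on (sphere 0 1) (\<lambda>v. norm (f v))"
    using assms by (intro continuous_intros linear_continuous_on) (simp add: linear_conv_bounded_linear)
  moreover have "sphere (0::'a) 1 \<noteq> {}" by simp
  ultimately obtain v where v: "v \<in> sphere 0 1" "\<And>u. u \<in> sphere 0 1 \<Longrightarrow> norm (f v) \<le> norm (f u)"
    using continuous_attains_inf[OF compact_sphere] by metis
  have "norm (f v) * norm w \<le> norm (f w)" for w
  proof (cases "w = 0")
    case False
    then have "norm (f v) \<le> norm (f (w /\<^sub>R norm w))" by (intro v(2)) simp
    also have "\<dots> = norm (f w) / norm w" using assms by (simp add: linear_cmul divide_inverse_commute)
    finally show ?thesis using False by (simp add: field_simps)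
  qed simp
  with v(1) show ?thesis by (intro that[of v]) auto
qed

text \<open>The quadratic \<open>t \<mapsto> |f (v + t w)|^2 - m |v + t w|^2\<close> is nonnegative
  and vanishes at \<open>t = 0\<close>, so its linear coefficient is zero. This is the weak form of
  the eigenvalue equation.\<close>

lemma linear_norm_min_stationary:
  fixes f :: "'a::real_inner \<Rightarrow> 'b::real_inner"
  assumes f: "linear f" and ge: "\<And>w. m * (norm w)\<^sup>2 \<le> (norm (f w))\<^sup>2"
    and eq: "(norm (f v))\<^sup>2 = m * (norm v)\<^sup>2"
  shows "f v \<bullet> f w = m * (v \<bullet> w)"
proof -
  define a c where "a = f v \<bullet> f w - m * (v \<bullet> w)" and "c = f w \<bullet> f w - m * (w \<bullet> w)"
  have *: "0 \<le> 2 * t * a + t\<^sup>2 * c" for t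
  proof -
    have "m * (norm (v + t *\<^sub>R w))\<^sup>2 \<le> (norm (f v + t *\<^sub>R f w))\<^sup>2"
      using ge[of "v + t *\<^sub>R w"] by (simp add: linear_add[OF f] linear_cmul[OF f])
    then show ?thesis using eq unfolding a_def c_def
      by (simp add: power2_norm_eq_inner inner_simps inner_commute algebra_simps)
         (simp add: power2_eq_square algebra_simps)
  qed
  have c: "0 \<le> c" using ge[of w] by (simp add: c_def power2_norm_eq_inner)
  \<comment> \<open>The test value \<open>- a / (c + 1)\<close> stands in for the vertex
    \<open>- a / c\<close>, which fails for \<open>c = 0\<close>; it still makes the quadratic
    negative unless \<open>a = 0\<close>.\<close>
  have "2 * (- a / (c + 1)) * a + (- a / (c + 1))\<^sup>2 * c = - (a\<^sup>2 * (c + 2)) / (c + 1)\<^sup>2"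
    using c by (simp add: divide_simps power2_eq_square) (simp add: algebra_simps)
  with *[of "- a / (c + 1)"] have "0 \<le> - (a\<^sup>2 * (c + 2)) / (c + 1)\<^sup>2" by simp
  then have "a\<^sup>2 * (c + 2) \<le> 0" using c by (simp add: divide_simps)
  then have "a = 0" using c by (smt (verit) mult_pos_pos zero_less_power2)
  then show ?thesis by (simp add: a_def)
qed

lemma inner_transpose_matrix_vector:
  fixes X :: "real^'n^'m"
  shows "v \<bullet> (transpose X *v w) = (X *v v) \<bullet> w"
  by (simp add: dot_lmul_matrix inner_commute[of v] inner_commute[of _ w])

text \<open>A unit vector of minimal stretch is an eigenvector of the Gram matrix, and every
  eigenvalue is a Rayleigh quotient, hence no smaller. So the \<open>LEAST\<close> in
  \<open>smallest_sv\<close> exists and is the squared minimal stretch.\<close>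

lemma smallest_sv_min:
  fixes X :: "real^'n^'m"
  obtains v where "norm v = 1" "norm (X *v v) = smallest_sv X"
    "\<And>w. smallest_sv X * norm w \<le> norm (X *v w)"
proof -
  obtain v where v: "norm v = 1" "\<And>w. norm (X *v v) * norm w \<le> norm (X *v w)"
    using linear_norm_min_exists[OF matrix_vector_mul_linear[of X]] by blast
  define m where "m = (norm (X *v v))\<^sup>2"
  have ge: "m * (norm w)\<^sup>2 \<le> (norm (X *v w))\<^sup>2" for w
    using power_mono[OF v(2)[of w], of 2] by (simp add: m_def power_mult_distrib)
  have st: "(X *v v) \<bullet> (X *v w) = m * (v \<bullet> w)" for w
    by (rule linear_norm_min_stationary[OF matrix_vector_mul_linear ge]) (simp add: m_def v)
  have "(LEAST l. is_eigenvalue (transpose X ** X) l) = m"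
  proof (rule Least_equality)
    have "w \<bullet> ((transpose X ** X) *v v) = w \<bullet> (m *\<^sub>R v)" for w
      using st[of w]
      by (simp only: matrix_vector_mul_assoc[symmetric] inner_transpose_matrix_vector
          inner_scaleR_right inner_commute)
    then have "(transpose X ** X) *v v = m *\<^sub>R v"
      by (rule vector_eq_ldot[THEN iffD1, OF allI])
    then show "is_eigenvalue (transpose X ** X) m"
      using v(1) unfolding is_eigenvalue_def by (intro exI[of _ v]) auto
  next
    fix l assume "is_eigenvalue (transpose X ** X) l"
    then obtain w where w: "w \<noteq> 0" "transpose X *v (X *v w) = l *\<^sub>R w"
      unfolding is_eigenvalue_def matrix_vector_mul_assoc[symmetric] by blast
    have "(norm (X *v w))\<^sup>2 = w \<bullet> (transpose X *v (X *v w))"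
      by (simp only: inner_transpose_matrix_vector power2_norm_eq_inner)
    also have "\<dots> = l * (norm w)\<^sup>2" using w by (simp add: power2_norm_eq_inner)
    finally show "m \<le> l" using ge[of w] w(1) by simp
  qed
  then have "smallest_sv X = norm (X *v v)" by (simp add: smallest_sv_def m_def)
  with v show ?thesis by (intro that[of v]) auto
qed

subsection \<open>Norms of block matrices\<close>

lemma sum_UNIV_Plus:
  fixes f :: "'a::finite + 'b::finite \<Rightarrow> 'c::comm_monoid_add"
  shows "sum f UNIV = (\<Sum>i\<in>UNIV. f (Inl i)) + (\<Sum>j\<in>UNIV. f (Inr j))"
  by (simp add: UNIV_Plus_UNIV[symmetric] sum.Plus del: UNIV_Plus_UNIV)

lemma power2_norm_vec: "(norm (x::real^'n))\<^sup>2 = (\<Sum>i\<in>UNIV. (x $ i)\<^sup>2)"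
  by (simp add: norm_vec_def L2_set_def sum_nonneg)

lemma power2_norm_matrix: "(norm (X::real^'n^'m))\<^sup>2 = (\<Sum>i\<in>UNIV. (norm (X $ i))\<^sup>2)"
  by (simp add: power2_norm_eq_inner inner_vec_def)

text \<open>Moves the size of perturbations to the product norm on pairs, in which continuity and
  derivatives are taken.\<close>

lemma norm_augment: "norm (augment E e) = norm (E, e)"
proof -
  have "(norm (augment E e))\<^sup>2 = (norm E)\<^sup>2 + (norm e)\<^sup>2"
    by (simp add: power2_norm_matrix power2_norm_vec augment_def hjoin_def sum_UNIV_Plus
        columnvector_def sum.distrib)
  then show ?thesis by (simp add: norm_Pair real_sqrt_unique[symmetric])
qed

lemma augment_vjoin_mult: "augment A b *v vjoin v w = A *v v + w $ 1 *\<^sub>R b"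
  by (simp add: vec_eq_iff augment_def hjoin_def vjoin_def matrix_vector_mult_def sum_UNIV_Plus
      columnvector_def UNIV_1)

lemma power2_norm_vjoin: "(norm (vjoin u v))\<^sup>2 = (norm u)\<^sup>2 + (norm v)\<^sup>2"
  by (simp add: power2_norm_vec vjoin_def sum_UNIV_Plus)

lemma vjoin_surj: obtains u v where "z = vjoin u v"
proof
  show "z = vjoin (\<chi> i. z $ Inl i) (\<chi> j. z $ Inr j)"
    by (simp add: vec_eq_iff vjoin_def split: sum.split)
qed

subsection \<open>Implicit differentiation along a continuous solution\<close>

text \<open>As \<open>h\<close> is continuous, inserting \<open>(p, h p)\<close> into the expansion
  of \<open>G\<close> gives \<open>P u + Q v = o(|u| + |v|)\<close>. Applying \<open>R\<close>
  yields \<open>v + R (P u) = o(|u| + |v|)\<close>, and absorbing the term in \<open>|v|\<close>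
  leaves \<open>o(|u|)\<close>.\<close>

lemma has_derivative_implicit:
  fixes G :: "'a::real_normed_vector \<times> 'b::real_normed_vector \<Rightarrow> 'c::real_normed_vector"
  assumes G: "(G has_derivative (\<lambda>(u, v). P u + Q v)) (at (a, h a))"
    and P: "bounded_linear P" and R: "bounded_linear R" and RQ: "\<And>v. R (Q v) = v"
    and cont: "isCont h a" and zero: "\<forall>\<^sub>F p in nhds a. G (p, h p) = 0"
  shows "(h has_derivative (\<lambda>u. - R (P u))) (at a)"
  unfolding has_derivative_at_alt
proof (intro conjI allI impI)
  interpret R: bounded_linear R by fact
  have RP: "bounded_linear (\<lambda>u. R (P u))" by (rule bounded_linear_compose[OF R P])
  then show "bounded_linear (\<lambda>u. - R (P u))" by (rule bounded_linear_minus)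
  fix e :: real assume e: "0 < e"
  obtain K where K: "0 < K" "\<And>z. norm (R z) \<le> norm z * K" using R.pos_bounded by blast
  obtain B where B: "0 < B" "\<And>z. norm (R (P z)) \<le> norm z * B" using bounded_linear.pos_bounded[OF RP] by blast
  \<comment> \<open>The bound \<open>1/2\<close> lets \<open>\<eta> * norm w\<close> be absorbed on
    the left; the other one makes the final constant \<open>2 * \<eta> * (1 + B)\<close> at most
    \<open>e\<close>. The tolerance \<open>\<eta> / K\<close> used below pays for the factor
    \<open>K\<close> of \<open>R\<close>.\<close>
  define \<eta> where "\<eta> = min (1/2) (e / (2 * (1 + B)))"
  have \<eta>: "0 < \<eta>" "\<eta> \<le> 1/2"
    using e B(1) by (simp add: \<eta>_def) (simp only: \<eta>_def min.cobounded1)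
  have "\<eta> \<le> e / (2 * (1 + B))" by (simp add: \<eta>_def)
  then have \<eta>e: "2 * \<eta> * (1 + B) \<le> e" using B(1) by (simp add: field_simps)
  have "0 < \<eta> / K" using \<eta> K by simp
  then obtain d where d: "0 < d" "\<And>y. norm (y - (a, h a)) < d \<Longrightarrow>
      norm (G y - G (a, h a) - (case y - (a, h a) of (u, v) \<Rightarrow> P u + Q v)) \<le> \<eta> / K * norm (y - (a, h a))"
    using G unfolding has_derivative_at_alt by metis
  have "isCont (\<lambda>p. (p, h p)) a" using cont by (intro continuous_intros)
  then obtain d1 where d1: "0 < d1" "\<And>p. dist p a < d1 \<Longrightarrow> dist (p, h p) (a, h a) < d"
    unfolding continuous_at_eps_delta using d(1) by metis
  obtain d2 where d2: "0 < d2" "\<And>p. dist p a < d2 \<Longrightarrow> G (p, h p) = 0"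
    using zero unfolding eventually_nhds_metric by metis
  have "norm (h p - h a - - R (P (p - a))) \<le> e * norm (p - a)" if p: "norm (p - a) < min d1 d2" for p
  proof -
    define u v w where "u = p - a" and "v = h p - h a" and "w = v + R (P u)"
    have "norm (G (p, h p) - G (a, h a) - (P u + Q v)) \<le> \<eta> / K * norm ((p, h p) - (a, h a))"
      using d(2)[of "(p, h p)"] d1(2)[of p] p by (simp add: dist_norm u_def v_def)
    moreover have "G (p, h p) = 0" "G (a, h a) = 0" using d2 p by (auto simp: dist_norm)
    ultimately have "norm (P u + Q v) \<le> \<eta> / K * norm (u, v)"
      using norm_minus_cancel[of "P u + Q v"] by (simp add: u_def v_def)
    also have "\<dots> \<le> \<eta> / K * (norm u + norm v)"
      using \<eta>(1) K(1) by (intro mult_left_mono) (simp_all add: norm_Pair_le)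
    finally have "norm (P u + Q v) * K \<le> \<eta> * (norm u + norm v)"
      using K(1) by (simp add: field_simps)
    moreover have "R (P u + Q v) = w" by (simp add: R.add RQ w_def)
    ultimately have 1: "norm w \<le> \<eta> * (norm u + norm v)"
      using K(2)[of "P u + Q v"] by simp
    have "norm v \<le> norm w + norm u * B"
      using norm_triangle_ineq4[of w "R (P u)"] B(2)[of u] by (simp add: w_def)
    then have "\<eta> * norm v \<le> \<eta> * (norm w + norm u * B)" using \<eta>(1) by simp
    with 1 have "norm w \<le> \<eta> * (1 + B) * norm u + \<eta> * norm w"
      by (simp add: algebra_simps)
    moreover have "\<eta> * norm w \<le> 1/2 * norm w" using \<eta>(2) by (intro mult_right_mono) auto
    ultimately have "norm w \<le> (2 * \<eta> * (1 + B)) * norm u" by simp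
    also have "\<dots> \<le> e * norm u" using \<eta>e by (intro mult_right_mono) auto
    finally show ?thesis by (simp add: w_def u_def v_def)
  qed
  then show "\<exists>d>0. \<forall>y. norm (y - a) < d \<longrightarrow> norm (h y - h a - - R (P (y - a))) \<le> e * norm (y - a)"
    using d1(1) d2(1) by (intro exI[of _ "min d1 d2"]) auto
qed

subsection \<open>Total least squares as a fractional minimisation\<close>

text \<open>The Rayleigh quotient of the Gram matrix of \<open>[A, b]\<close> at
  \<open>(x, -1)\<close>; equally the least squared size of a perturbation that makes
  \<open>x\<close> solve the system.\<close>

definition tls_obj :: "real^'n^'m \<Rightarrow> real^'m \<Rightarrow> real^'n \<Rightarrow> real" where
  "tls_obj A b x = (norm (b - A *v x))\<^sup>2 / (1 + (norm x)\<^sup>2)"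

lemma one_plus_norm_pos: "0 < 1 + (norm x)\<^sup>2"
  by (simp add: add_pos_nonneg)

lemma norm_matrix_vector_mult_le:
  fixes E :: "real^'n^'m"
  shows "norm (E *v x) \<le> norm E * norm x"
proof -
  have "(norm (E *v x))\<^sup>2 = (\<Sum>i\<in>UNIV. (E $ i \<bullet> x)\<^sup>2)"
    by (simp add: power2_norm_vec matrix_vector_mul_component)
  also have "\<dots> \<le> (\<Sum>i\<in>UNIV. (norm (E $ i))\<^sup>2 * (norm x)\<^sup>2)"
    by (intro sum_mono) (metis Cauchy_Schwarz_ineq power2_norm_eq_inner)
  also have "\<dots> = (norm E * norm x)\<^sup>2"
    by (simp add: power2_norm_matrix power_mult_distrib sum_distrib_right)
  finally show ?thesis by (rule power2_le_imp_le) simp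
qed

text \<open>\<open>e - E *v x\<close> is \<open>[E, e]\<close> applied to \<open>(-x, 1)\<close>, so
  this is Cauchy-Schwarz. It serves both the lower bound on feasible perturbations and the
  dependence of the objective on the data.\<close>

lemma norm_residual_perturb_le:
  fixes E :: "real^'n^'m"
  shows "norm (e - E *v x) \<le> norm (E, e) * sqrt (1 + (norm x)\<^sup>2)"
proof -
  have "norm (e - E *v x) \<le> norm E * norm x + norm e * 1"
    using norm_triangle_ineq4[of e "E *v x"] norm_matrix_vector_mult_le[of E x] by simp
  also have "\<dots> \<le> norm (E, e) * norm (norm x, 1::real)"
    using norm_cauchy_schwarz[of "(norm E, norm e)" "(norm x, 1::real)"]
    by (simp add: norm_Pair)
  finally show ?thesis by (simp add: norm_Pair add.commute)
qed

text \<open>For fixed \<open>x\<close>, Cauchy-Schwarz bounds the squared norm of a feasible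
  perturbation below by the objective, and a rank-one perturbation attains it.\<close>

lemma is_tls_solution_iff:
  "is_tls_solution A b x \<longleftrightarrow> (\<forall>x'. tls_obj A b x \<le> tls_obj A b x')"
proof -
  have lower: "tls_obj A b y \<le> (norm (augment E e))\<^sup>2" if "tls_feasible A b E e y" for E e y
  proof -
    have "b - A *v y = - (e - E *v y)"
      using that by (simp add: tls_feasible_def algebra_simps matrix_vector_mult_add_rdistrib)
    then have "norm (b - A *v y) \<le> norm (E, e) * sqrt (1 + (norm y)\<^sup>2)"
      using norm_residual_perturb_le by (metis norm_minus_cancel)
    then have "(norm (b - A *v y))\<^sup>2 \<le> (norm (E, e) * sqrt (1 + (norm y)\<^sup>2))\<^sup>2"
      by (rule power_mono) simp
    also have "\<dots> = (norm (E, e))\<^sup>2 * (1 + (norm y)\<^sup>2)"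
      using one_plus_norm_pos[of y] by (simp add: power_mult_distrib)
    finally show ?thesis
      using one_plus_norm_pos[of y] by (simp add: tls_obj_def norm_augment divide_le_eq)
  qed
  have attained: "\<exists>E e. tls_feasible A b E e y \<and> (norm (augment E e))\<^sup>2 = tls_obj A b y" for y
  proof -
    define c where "c = 1 + (norm y)\<^sup>2"
    have c: "c > 0" using one_plus_norm_pos by (simp add: c_def)
    define r where "r = b - A *v y"
    \<comment> \<open>The equality case of Cauchy-Schwarz: \<open>[E, e]\<close> is the rank-one
      matrix with column \<open>r / c\<close> and row \<open>(y, -1)\<close>.\<close>
    define E where "E = (\<chi> i j. r $ i * y $ j / c)"
    define e where "e = - r /\<^sub>R c"
    have row: "E $ i = (r $ i / c) *\<^sub>R y" for i
      by (simp add: vec_eq_iff E_def)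
    have "E *v y = ((norm y)\<^sup>2 / c) *\<^sub>R r"
      by (simp add: vec_eq_iff matrix_vector_mul_component row power2_norm_eq_inner)
    also have "\<dots> = r + e"
      using c by (simp add: vec_eq_iff e_def divide_simps) (simp add: c_def algebra_simps)
    finally have "tls_feasible A b E e y"
      by (simp add: tls_feasible_def r_def matrix_vector_mult_add_rdistrib)
    moreover have "(norm E)\<^sup>2 = (\<Sum>i\<in>UNIV. (r $ i)\<^sup>2 * ((norm y)\<^sup>2 / c\<^sup>2))"
      by (simp add: power2_norm_matrix row power_mult_distrib power_divide)
    then have "(norm E)\<^sup>2 = (norm r)\<^sup>2 * (norm y)\<^sup>2 / c\<^sup>2"
      by (simp only: sum_distrib_right[symmetric] power2_norm_vec[symmetric]) simp
    moreover have "(norm e)\<^sup>2 = (norm r)\<^sup>2 / c\<^sup>2"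
      by (simp add: e_def power_mult_distrib power_inverse divide_inverse)
    ultimately have "tls_feasible A b E e y \<and> (norm (augment E e))\<^sup>2 = (norm r)\<^sup>2 * c / c\<^sup>2"
      by (simp add: norm_augment norm_Pair c_def add_divide_distrib[symmetric] algebra_simps)
    then show ?thesis using c
      by (intro exI[of _ E] exI[of _ e]) (simp add: tls_obj_def c_def r_def power2_eq_square)
  qed
  show ?thesis
  proof
    assume "is_tls_solution A b x"
    then obtain E e where Ee: "tls_feasible A b E e x"
      "\<And>E' e' x'. tls_feasible A b E' e' x' \<Longrightarrow> norm (augment E e) \<le> norm (augment E' e')"
      unfolding is_tls_solution_def by blast
    show "\<forall>x'. tls_obj A b x \<le> tls_obj A b x'"
    proof
      fix x'
      obtain E' e' where E'e': "tls_feasible A b E' e' x'" "(norm (augment E' e'))\<^sup>2 = tls_obj A b x'"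
        using attained by blast
      note lower[OF Ee(1)]
      also have "(norm (augment E e))\<^sup>2 \<le> (norm (augment E' e'))\<^sup>2"
        using Ee(2)[OF E'e'(1)] by (intro power_mono) auto
      finally show "tls_obj A b x \<le> tls_obj A b x'" using E'e'(2) by simp
    qed
  next
    assume *: "\<forall>x'. tls_obj A b x \<le> tls_obj A b x'"
    obtain E e where Ee: "tls_feasible A b E e x" "(norm (augment E e))\<^sup>2 = tls_obj A b x"
      using attained by blast
    moreover have "norm (augment E e) \<le> norm (augment E' e')" if "tls_feasible A b E' e' x'" for E' e' x'
    proof (rule power2_le_imp_le)
      show "(norm (augment E e))\<^sup>2 \<le> (norm (augment E' e'))\<^sup>2"
        using *[rule_format, of x'] lower[OF that] unfolding Ee(2) by (rule order_trans)
    qed simp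
    ultimately show "is_tls_solution A b x"
      unfolding is_tls_solution_def by (intro exI[of _ E] exI[of _ e]) simp
  qed
qed

text \<open>The homogeneous problem for \<open>(v, t) \<mapsto> A v - t b\<close> has a minimiser on
  the unit sphere. With \<open>t = 0\<close> its stretch would be at least \<open>s\<close>, against
  the value at \<open>x1\<close>; so dividing by \<open>t\<close> brings it to the form
  \<open>(y, 1)\<close>, where the squared stretch is the objective.\<close>

lemma tls_obj_minimizer:
  fixes A :: "real^'n^'m"
  assumes s: "0 \<le> s" "\<And>v. s * norm v \<le> norm (A *v v)" and x1: "tls_obj A b x1 < s\<^sup>2"
  obtains x where "\<And>y. tls_obj A b x \<le> tls_obj A b y"
proof -
  define f where "f = (\<lambda>(v, t). A *v v - t *\<^sub>R b)"
  have f: "linear f"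
    by (rule linearI) (auto simp: f_def algebra_simps matrix_vector_right_distrib matrix_vector_mult_scaleR)
  obtain z where z: "norm z = 1" "\<And>w. norm (f z) * norm w \<le> norm (f w)"
    using linear_norm_min_exists[OF f] by blast
  obtain v t where vt: "z = (v, t)" by (cases z)
  have f1: "(norm (f (y, 1)))\<^sup>2 = tls_obj A b y * (norm (y, 1::real))\<^sup>2" for y
    using one_plus_norm_pos[of y] by (simp add: f_def tls_obj_def norm_Pair norm_minus_commute add.commute)
  have ge: "(norm (f z))\<^sup>2 \<le> tls_obj A b y" for y
  proof -
    have "(norm (f z))\<^sup>2 * (norm (y, 1::real))\<^sup>2 \<le> (norm (f (y, 1)))\<^sup>2"
      using power_mono[OF z(2)[of "(y, 1)"], of 2] by (simp add: power_mult_distrib)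
    moreover have "0 < (norm (y, 1::real))\<^sup>2" by (simp add: zero_prod_def)
    ultimately show ?thesis unfolding f1 by simp
  qed
  have "t \<noteq> 0"
  proof
    assume "t = 0"
    with z(1) have "s \<le> norm (f z)" using s(2)[of v] by (simp add: vt f_def norm_Pair)
    then have "s\<^sup>2 \<le> (norm (f z))\<^sup>2" using s(1) by (rule power_mono)
    with ge[of x1] x1 show False by simp
  qed
  have "z = t *\<^sub>R (v /\<^sub>R t, 1)" using \<open>t \<noteq> 0\<close> by (simp add: vt)
  then have "f z = t *\<^sub>R f (v /\<^sub>R t, 1)" "norm z = \<bar>t\<bar> * norm (v /\<^sub>R t, 1::real)"
    by (metis f linear_cmul, metis norm_scaleR)
  then have "(norm (f z))\<^sup>2 = t\<^sup>2 * (norm (f (v /\<^sub>R t, 1)))\<^sup>2" "1 = t\<^sup>2 * (norm (v /\<^sub>R t, 1::real))\<^sup>2"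
    using z(1) by (simp_all add: power_mult_distrib) (metis one_power2 power2_abs power_mult_distrib)
  then have "(norm (f z))\<^sup>2 = tls_obj A b (v /\<^sub>R t)"
    unfolding f1 by (metis mult.assoc mult.commute mult.right_neutral)
  with ge show ?thesis by (intro that[of "v /\<^sub>R t"]) simp
qed

text \<open>With the quotient frozen at its minimum \<open>m\<close>, the function
  \<open>|b - A y|^2 - m (1 + |y|^2)\<close> is quadratic in \<open>y\<close>, nonnegative and zero
  at \<open>x\<close>. Its linear part at \<open>x\<close> must vanish, and the exact expansion
  keeps only the quadratic part.\<close>

lemma tls_obj_minimizer_stationary:
  fixes A :: "real^'n^'m"
  assumes min: "\<And>y. tls_obj A b x \<le> tls_obj A b y"
  shows "(b - A *v x) v* A + tls_obj A b x *\<^sub>R x = 0"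
    and "(norm (b - A *v y))\<^sup>2 - tls_obj A b x * (1 + (norm y)\<^sup>2) =
      (norm (A *v (y - x)))\<^sup>2 - tls_obj A b x * (norm (y - x))\<^sup>2"
proof -
  define m r where "m = tls_obj A b x" and "r = b - A *v x"
  have r2: "(norm r)\<^sup>2 = m * (1 + (norm x)\<^sup>2)"
    using one_plus_norm_pos[of x] by (simp add: m_def r_def tls_obj_def)
  have q: "(norm (b - A *v (x + w)))\<^sup>2 - m * (1 + (norm (x + w))\<^sup>2) =
      (norm (A *v w))\<^sup>2 - m * (norm w)\<^sup>2 - 2 * (w \<bullet> (r v* A + m *\<^sub>R x))" for w
  proof -
    have "b - A *v (x + w) = r - A *v w" by (simp add: r_def matrix_vector_right_distrib)
    moreover have "(norm (r - A *v w))\<^sup>2 = m * (1 + (norm x)\<^sup>2) - 2 * (r \<bullet> (A *v w)) + (norm (A *v w))\<^sup>2"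
      unfolding r2[symmetric] by (simp add: power2_norm_eq_inner inner_simps inner_commute)
    moreover have "(norm (x + w))\<^sup>2 = (norm x)\<^sup>2 + 2 * (x \<bullet> w) + (norm w)\<^sup>2"
      by (simp add: power2_norm_eq_inner inner_simps inner_commute)
    ultimately show ?thesis
      by (simp add: inner_add_right inner_commute[of w] dot_lmul_matrix algebra_simps)
  qed
  have nonneg: "0 \<le> (norm (b - A *v y))\<^sup>2 - m * (1 + (norm y)\<^sup>2)" for y
    using min[of y] one_plus_norm_pos[of y] by (simp add: tls_obj_def[of A b y] m_def pos_le_divide_eq)
  show 0: "r v* A + m *\<^sub>R x = 0"
  proof (rule ccontr)
    define g where "g = r v* A + m *\<^sub>R x"
    assume "r v* A + m *\<^sub>R x \<noteq> 0"
    then have g: "0 < g \<bullet> g" by (simp add: g_def)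
    define c where "c = (norm (A *v g))\<^sup>2 - m * (norm g)\<^sup>2"
    have t: "2 * t * (g \<bullet> g) \<le> t\<^sup>2 * c" for t
      using nonneg[of "x + t *\<^sub>R g"] unfolding q g_def[symmetric] c_def
      by (simp add: matrix_vector_mult_scaleR power_mult_distrib algebra_simps)
    \<comment> \<open>A step along \<open>g\<close> so short that the quadratic term, at most
      \<open>t * (g \<bullet> g)\<close>, cannot outweigh the linear gain
      \<open>2 * t * (g \<bullet> g)\<close>.\<close>
    define t where "t = (g \<bullet> g) / (\<bar>c\<bar> + 1)"
    have "0 < t" using g by (simp add: t_def add_nonneg_pos)
    with t[of t] have "2 * (g \<bullet> g) \<le> t * c" by (simp add: power2_eq_square)
    also have "\<dots> \<le> t * (\<bar>c\<bar> + 1)" using \<open>0 < t\<close> by (intro mult_left_mono) auto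
    also have "\<dots> = g \<bullet> g" by (simp add: t_def add_nonneg_pos)
    finally show False using g by simp
  qed
  show "(norm (b - A *v y))\<^sup>2 - m * (1 + (norm y)\<^sup>2) =
      (norm (A *v (y - x)))\<^sup>2 - m * (norm (y - x))\<^sup>2"
    using q[of "y - x"] 0 by simp
qed

text \<open>The hypotheses say that \<open>s\<^sup>2\<close> separates the smallest squared singular values of \<open>[A, b]\<close> and
  \<open>A\<close>. Unlike a comparison of the singular values themselves, they are visibly stable under
  perturbations of \<open>A\<close> and \<open>b\<close>.\<close>

lemma tls_solution_minimizer:
  fixes A :: "real^'n^'m"
  assumes s: "0 \<le> s" "\<And>v. s * norm v \<le> norm (A *v v)" and x1: "tls_obj A b x1 < s\<^sup>2"
  shows "tls_obj A b (tls_solution A b) \<le> tls_obj A b y"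
    and "(s\<^sup>2 - tls_obj A b (tls_solution A b)) * (norm (y - tls_solution A b))\<^sup>2 \<le>
      (tls_obj A b y - tls_obj A b (tls_solution A b)) * (1 + (norm y)\<^sup>2)"
proof -
  obtain x where x: "\<And>y. tls_obj A b x \<le> tls_obj A b y"
    using tls_obj_minimizer[OF assms] by blast
  \<comment> \<open>The expansion around the minimiser has no linear term, and in its quadratic part
    \<open>A\<close> stretches by at least \<open>s\<close>.\<close>
  have growth: "(s\<^sup>2 - tls_obj A b x) * (norm (y - x))\<^sup>2 \<le>
      (tls_obj A b y - tls_obj A b x) * (1 + (norm y)\<^sup>2)" for y
  proof -
    have "(s * norm (y - x))\<^sup>2 \<le> (norm (A *v (y - x)))\<^sup>2"
      using s by (intro power_mono) auto
    then have "(s\<^sup>2 - tls_obj A b x) * (norm (y - x))\<^sup>2 \<le>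
        (norm (A *v (y - x)))\<^sup>2 - tls_obj A b x * (norm (y - x))\<^sup>2"
      by (simp add: power_mult_distrib algebra_simps)
    also have "\<dots> = (norm (b - A *v y))\<^sup>2 - tls_obj A b x * (1 + (norm y)\<^sup>2)"
      by (rule tls_obj_minimizer_stationary(2)[OF x, symmetric])
    also have "\<dots> = (tls_obj A b y - tls_obj A b x) * (1 + (norm y)\<^sup>2)"
      using one_plus_norm_pos[of y] by (simp add: tls_obj_def[of A b y] left_diff_distrib)
    finally show ?thesis .
  qed
  \<comment> \<open>By the growth estimate a second minimiser coincides with \<open>x\<close>, so
    the definite description denotes \<open>x\<close>.\<close>
  have "tls_solution A b = x"
    unfolding tls_solution_def
  proof (rule the_equality)
    show "is_tls_solution A b x" using x by (simp add: is_tls_solution_iff)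
    fix y assume "is_tls_solution A b y"
    then have "tls_obj A b y = tls_obj A b x" using x by (simp add: is_tls_solution_iff order_antisym)
    with growth[of y] have "(s\<^sup>2 - tls_obj A b x) * (norm (y - x))\<^sup>2 \<le> 0" by simp
    moreover have "0 < s\<^sup>2 - tls_obj A b x" using x[of x1] x1 by simp
    ultimately show "y = x" by (simp add: mult_le_0_iff)
  qed
  with x growth show "tls_obj A b (tls_solution A b) \<le> tls_obj A b y"
    "(s\<^sup>2 - tls_obj A b (tls_solution A b)) * (norm (y - tls_solution A b))\<^sup>2 \<le>
      (tls_obj A b y - tls_obj A b (tls_solution A b)) * (1 + (norm y)\<^sup>2)" by simp_all
qed

text \<open>The root of the objective is the residual norm divided by the length of
  \<open>(x, -1)\<close>. The Lipschitz constant 1 is the same for all \<open>x\<close>, which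
  permits comparing minimal values at different data.\<close>

lemma sqrt_tls_obj_lipschitz:
  fixes A A' :: "real^'n^'m"
  shows "sqrt (tls_obj A b x) \<le> sqrt (tls_obj A' b' x) + dist (A, b) (A', b')"
proof -
  define c where "c = sqrt (1 + (norm x)\<^sup>2)"
  have c: "c > 0" using one_plus_norm_pos by (simp add: c_def)
  have obj: "sqrt (tls_obj A b x) = norm (b - A *v x) / c" for A :: "real^'n^'m" and b :: "real^'m"
    by (simp add: tls_obj_def c_def real_sqrt_divide)
  have "norm (b - A *v x) \<le> norm (b' - A' *v x) + norm ((b - b') - (A - A') *v x)"
    using norm_triangle_ineq[of "b' - A' *v x" "(b - b') - (A - A') *v x"]
    by (simp add: matrix_vector_mult_diff_rdistrib)
  also have "\<dots> \<le> norm (b' - A' *v x) + dist (A, b) (A', b') * c"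
    using norm_residual_perturb_le[of "b - b'" "A - A'" x] by (simp add: dist_norm c_def)
  finally show ?thesis using c by (simp add: obj field_simps)
qed

subsection \<open>Derivative of the solution map\<close>

lemma bounded_bilinear_vector_matrix_mult:
  "bounded_bilinear ((v*) :: real^'m \<Rightarrow> real^'n^'m \<Rightarrow> real^'n)"
  unfolding bilinear_conv_bounded_bilinear[symmetric] bilinear_def
  by (intro conjI allI linearI)
     (simp_all add: vec_eq_iff vector_matrix_mult_def distrib_left distrib_right sum.distrib sum_distrib_left mult_ac)

lemma bounded_bilinear_matrix_vector_mult:
  "bounded_bilinear ((*v) :: real^'n^'m \<Rightarrow> real^'n \<Rightarrow> real^'m)"
  unfolding bilinear_conv_bounded_bilinear[symmetric] bilinear_def
  by (intro conjI allI linearI)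
     (simp_all add: vec_eq_iff matrix_vector_mult_def distrib_left distrib_right sum.distrib sum_distrib_left mult_ac)

lemmas has_derivative_matrix_mult [derivative_intros] =
  bounded_bilinear.FDERIV[OF bounded_bilinear_vector_matrix_mult]
  bounded_bilinear.FDERIV[OF bounded_bilinear_matrix_vector_mult]

text \<open>Equals \<open>-(1 + |x|^2)/2\<close> times the gradient of \<open>tls_obj\<close> in
  \<open>x\<close>.\<close>

definition tls_stationarity :: "((real^'n^'m) \<times> (real^'m)) \<times> (real^'n) \<Rightarrow> real^'n" where
  "tls_stationarity = (\<lambda>(p, x). (snd p - fst p *v x) v* fst p + tls_obj (fst p) (snd p) x *\<^sub>R x)"

lemma has_derivative_tls_stationarity:
  fixes A :: "real^'n^'m"
  assumes zero: "tls_stationarity ((A, b), x) = 0"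
  defines "r \<equiv> b - A *v x" and "s \<equiv> tls_obj A b x"
  shows "(tls_stationarity has_derivative
    (\<lambda>(u, v). (r v* fst u + (snd u - fst u *v x) v* A
        + (2 * (r \<bullet> (snd u - fst u *v x)) / (1 + (norm x)\<^sup>2)) *\<^sub>R x)
      + (s *\<^sub>R v - (A *v v) v* A))) (at ((A, b), x))"
proof -
  define c where "c = 1 + (norm x)\<^sup>2"
  have c: "c > 0" "1 + x \<bullet> x = c"
    using one_plus_norm_pos[of x] by (simp_all add: c_def power2_norm_eq_inner)
  have rr: "r \<bullet> r = s * c"
    using c(1) by (simp add: s_def tls_obj_def r_def power2_norm_eq_inner c(2))
  \<comment> \<open>Stationarity tested against \<open>v\<close>; it cancels the
    \<open>v\<close>-dependence in the quotient rule for the objective below.\<close>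
  have rA: "r \<bullet> (A *v v) = - s * (x \<bullet> v)" for v
  proof -
    have "(r v* A + s *\<^sub>R x) \<bullet> v = 0"
      using zero by (simp add: tls_stationarity_def r_def s_def)
    then show ?thesis by (simp add: inner_add_left dot_lmul_matrix)
  qed
  let ?p = "((A, b), x)"
  let ?R = "\<lambda>q::((real^'n^'m) \<times> (real^'m)) \<times> (real^'n). snd (fst q) - fst (fst q) *v snd q"
  let ?dR = "\<lambda>q::((real^'n^'m) \<times> (real^'m)) \<times> (real^'n).
    snd (fst q) - (A *v snd q + fst (fst q) *v x)"
  have R: "(?R has_derivative ?dR) (at ?p)"
    by (rule derivative_eq_intros refl)+ (simp add: fun_eq_iff)
  have obj: "((\<lambda>q. (?R q \<bullet> ?R q) / (1 + snd q \<bullet> snd q)) has_derivative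
     (\<lambda>q. 2 * (r \<bullet> (snd (fst q) - fst (fst q) *v x)) / c)) (at ?p)"
  proof -
    have "((\<lambda>q. (?R q \<bullet> ?R q) / (1 + snd q \<bullet> snd q)) has_derivative
     (\<lambda>q. (2 * (r \<bullet> ?dR q) * c - (r \<bullet> r) * (2 * (x \<bullet> snd q))) / (c * c))) (at ?p)"
      apply (rule R derivative_eq_intros refl)+
      using c apply (simp)
      using c(1) apply (simp add: fun_eq_iff r_def[symmetric] inner_commute c(2))
      apply (simp add: field_simps)
      done
    moreover have "(2 * (r \<bullet> ?dR q) * c - (r \<bullet> r) * (2 * (x \<bullet> snd q))) / (c * c) =
        2 * (r \<bullet> (snd (fst q) - fst (fst q) *v x)) / c" for q
      using c(1) by (simp add: inner_diff_right inner_add_right rA rr field_simps)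
    ultimately show ?thesis by simp
  qed
  have "tls_stationarity = (\<lambda>q. ?R q v* fst (fst q) + ((?R q \<bullet> ?R q) / (1 + snd q \<bullet> snd q)) *\<^sub>R snd q)"
    by (simp add: tls_stationarity_def tls_obj_def power2_norm_eq_inner fun_eq_iff)
  moreover have "((\<lambda>q. ?R q v* fst (fst q) + ((?R q \<bullet> ?R q) / (1 + snd q \<bullet> snd q)) *\<^sub>R snd q)
    has_derivative (\<lambda>q. (r v* fst (fst q) + ?dR q v* A) +
       (s *\<^sub>R snd q + (2 * (r \<bullet> (snd (fst q) - fst (fst q) *v x)) / c) *\<^sub>R x))) (at ?p)"
    apply (rule obj R derivative_eq_intros refl)+
    using c(1) apply (simp add: r_def[symmetric] rr c(2) fun_eq_iff)
    done
  moreover have "(\<lambda>q. (r v* fst (fst q) + ?dR q v* A) +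
       (s *\<^sub>R snd q + (2 * (r \<bullet> (snd (fst q) - fst (fst q) *v x)) / c) *\<^sub>R x)) =
   (\<lambda>(u, v). (r v* fst u + (snd u - fst u *v x) v* A
        + (2 * (r \<bullet> (snd u - fst u *v x)) / c) *\<^sub>R x)
      + (s *\<^sub>R v - (A *v v) v* A))"
    by (auto simp: fun_eq_iff algebra_simps vector_matrix_left_distrib
        bounded_bilinear.diff_left[OF bounded_bilinear_vector_matrix_mult]
        bounded_bilinear.add_left[OF bounded_bilinear_vector_matrix_mult])
  ultimately show ?thesis unfolding c_def by metis
qed

text \<open>The hypotheses persist near \<open>(A, b)\<close> with a slightly smaller constant in
  place of \<open>s\<close>. Quadratic growth at the perturbed data, tested at the unperturbed
  solution, bounds the displacement by an objective excess that tends to zero.\<close>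

lemma tls_solution_continuous_stationary:
  fixes A :: "real^'n^'m"
  assumes s: "0 \<le> s" "\<And>v. s * norm v \<le> norm (A *v v)" and x1: "tls_obj A b x1 < s\<^sup>2"
  shows "isCont (\<lambda>p. tls_solution (fst p) (snd p)) (A, b)"
    and "\<forall>\<^sub>F p in nhds (A, b). tls_stationarity (p, tls_solution (fst p) (snd p)) = 0"
proof -
  let ?x = "\<lambda>p :: (real^'n^'m) \<times> (real^'m). tls_solution (fst p) (snd p)"
  let ?f = "\<lambda>p :: (real^'n^'m) \<times> (real^'m). tls_obj (fst p) (snd p)"
  define p0 where "p0 = (A, b)"
  define x0 where "x0 = ?x p0"
  note min0 = tls_solution_minimizer[OF assms, folded p0_def]
  have m0: "?f p0 x0 < s\<^sup>2" using min0(1)[of x1] x1 by (simp add: x0_def p0_def)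
  have obj_nonneg: "0 \<le> tls_obj A' b' y" for A' :: "real^'n^'m" and b' y
    by (simp add: tls_obj_def)
  then have s0: "0 < s" using m0 s(1) by (cases "s = 0") (simp_all add: p0_def not_less[symmetric])
  \<comment> \<open>Strictly inside the gap, \<open>t\<close> leaves room to lose
    \<open>s - t\<close> in the stretch of the matrix and \<open>t - sqrt (?f p0 x0)\<close> in the
    objective.\<close>
  obtain t where t: "sqrt (?f p0 x0) < t" "t < s"
    using dense[of "sqrt (?f p0 x0)" s] m0 s0 real_sqrt_less_mono[OF m0] by auto
  have t0: "0 < t" using t(1) obj_nonneg[of A b x0] by (meson le_less_trans real_sqrt_ge_zero p0_def obj_nonneg)
  define d where "d = min (s - t) (t - sqrt (?f p0 x0))"
  have d: "0 < d" using t by (simp add: d_def)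
  have near: "t * norm v \<le> norm (fst p *v v)" "?f p x0 < t\<^sup>2" if "dist p p0 < d" for p v
  proof -
    have 1: "norm (fst p - A) < s - t"
      using that dist_fst_le[of p p0] by (simp add: d_def dist_norm p0_def)
    have "s * norm v \<le> norm (A *v v)" by (rule s(2))
    also have "\<dots> \<le> norm (fst p *v v) + norm ((fst p - A) *v v)"
      using norm_triangle_ineq4[of "fst p *v v" "(fst p - A) *v v"]
      by (simp add: matrix_vector_mult_diff_rdistrib)
    also have "norm ((fst p - A) *v v) \<le> (s - t) * norm v"
      using norm_matrix_vector_mult_le[of "fst p - A" v] 1 mult_right_mono[of "norm (fst p - A)" "s - t" "norm v"]
      by simp
    finally show "t * norm v \<le> norm (fst p *v v)" by (simp add: algebra_simps)
    have "sqrt (?f p x0) \<le> sqrt (?f p0 x0) + dist p p0"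
      using sqrt_tls_obj_lipschitz[of "fst p" "snd p" x0 "fst p0" "snd p0"] by simp
    also have "\<dots> < t" using that by (simp add: d_def)
    finally show "?f p x0 < t\<^sup>2"
      using t0 real_less_rsqrt real_sqrt_less_iff by (metis abs_of_pos real_sqrt_abs)
  qed
  have ev: "\<forall>\<^sub>F p in nhds p0. dist p p0 < d"
    using d by (auto simp: eventually_nhds_metric)
  show "\<forall>\<^sub>F p in nhds (A, b). tls_stationarity (p, ?x p) = 0"
    using ev unfolding p0_def
  proof eventually_elim
    case (elim p)
    have p: "dist p p0 < d" using elim by (simp add: p0_def)
    have "?f p (?x p) \<le> ?f p y" for y
      by (rule tls_solution_minimizer(1)[OF less_imp_le[OF t0] near[OF p]])
    then show ?case
      using tls_obj_minimizer_stationary(1)[of "fst p" "snd p" "?x p"] by (simp add: tls_stationarity_def)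
  qed
  \<comment> \<open>The right side avoids the unknown \<open>?x p\<close>: its objective value is
    replaced in the numerator by the Lipschitz lower bound, cut off at 0 so that squaring is
    monotone, and in the denominator by the value at \<open>x0\<close>. The numerator vanishes at
    \<open>p0\<close>.\<close>
  have growth: "(dist (?x p) x0)\<^sup>2 \<le>
      (?f p x0 - (max 0 (sqrt (?f p0 x0) - dist p p0))\<^sup>2) * (1 + (norm x0)\<^sup>2) / (t\<^sup>2 - ?f p x0)"
    if p: "dist p p0 < d" for p
  proof -
    note min = tls_solution_minimizer[OF less_imp_le[OF t0] near[OF p]]
    have "sqrt (?f p0 x0) \<le> sqrt (?f p0 (?x p))"
      using min0(1)[of "?x p"] by (simp add: x0_def p0_def)
    also have "\<dots> \<le> sqrt (?f p (?x p)) + dist p p0"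
      using sqrt_tls_obj_lipschitz[of "fst p0" "snd p0" "?x p" "fst p" "snd p"] by (simp add: dist_commute)
    finally have "max 0 (sqrt (?f p0 x0) - dist p p0) \<le> sqrt (?f p (?x p))"
      using obj_nonneg[of "fst p" "snd p" "?x p"] by simp
    then have "(max 0 (sqrt (?f p0 x0) - dist p p0))\<^sup>2 \<le> (sqrt (?f p (?x p)))\<^sup>2"
      by (rule power_mono) simp
    then have lower: "(max 0 (sqrt (?f p0 x0) - dist p p0))\<^sup>2 \<le> ?f p (?x p)"
      using obj_nonneg by simp
    have "(dist (?x p) x0)\<^sup>2 * (t\<^sup>2 - ?f p x0) \<le> (t\<^sup>2 - ?f p (?x p)) * (norm (x0 - ?x p))\<^sup>2"
      using min(1)[of x0]
      by (subst mult.commute) (simp add: dist_norm norm_minus_commute[of x0] mult_right_mono)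
    also have "\<dots> \<le> (?f p x0 - ?f p (?x p)) * (1 + (norm x0)\<^sup>2)"
      by (rule min(2))
    also have "\<dots> \<le> (?f p x0 - (max 0 (sqrt (?f p0 x0) - dist p p0))\<^sup>2) * (1 + (norm x0)\<^sup>2)"
      using lower one_plus_norm_pos[of x0] by (intro mult_right_mono) auto
    finally show ?thesis using near(2)[OF p] by (simp add: pos_le_divide_eq)
  qed
  have f_lim: "((\<lambda>p. ?f p x0) \<longlongrightarrow> ?f p0 x0) (at p0)"
    unfolding tls_obj_def using one_plus_norm_pos[of x0]
    by (intro tendsto_intros bounded_bilinear.tendsto[OF bounded_bilinear_matrix_vector_mult]) auto
  have "((\<lambda>p. (?f p x0 - (max 0 (sqrt (?f p0 x0) - dist p p0))\<^sup>2) * (1 + (norm x0)\<^sup>2) / (t\<^sup>2 - ?f p x0))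
      \<longlongrightarrow> (?f p0 x0 - (max 0 (sqrt (?f p0 x0) - dist p0 p0))\<^sup>2) * (1 + (norm x0)\<^sup>2) / (t\<^sup>2 - ?f p0 x0)) (at p0)"
    using near(2)[of p0] d by (intro tendsto_intros f_lim) auto
  also have "(?f p0 x0 - (max 0 (sqrt (?f p0 x0) - dist p0 p0))\<^sup>2) = 0"
    using obj_nonneg[of "fst p0" "snd p0" x0] by simp
  finally have "((\<lambda>p. (?f p x0 - (max 0 (sqrt (?f p0 x0) - dist p p0))\<^sup>2) * (1 + (norm x0)\<^sup>2) / (t\<^sup>2 - ?f p x0))
      \<longlongrightarrow> 0) (at p0)" by simp
  then have "((\<lambda>p. (dist (?x p) x0)\<^sup>2) \<longlongrightarrow> 0) (at p0)"
  proof (rule tendsto_sandwich[OF _ _ tendsto_const, rotated 2])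
    show "\<forall>\<^sub>F p in at p0. 0 \<le> (dist (?x p) x0)\<^sup>2" by simp
    show "\<forall>\<^sub>F p in at p0. (dist (?x p) x0)\<^sup>2 \<le>
      (?f p x0 - (max 0 (sqrt (?f p0 x0) - dist p p0))\<^sup>2) * (1 + (norm x0)\<^sup>2) / (t\<^sup>2 - ?f p x0)"
      using ev growth by (auto simp: eventually_at_filter elim: eventually_mono)
  qed
  then have "((\<lambda>p. sqrt ((dist (?x p) x0)\<^sup>2)) \<longlongrightarrow> sqrt 0) (at p0)"
    by (rule tendsto_real_sqrt)
  then have "(?x \<longlongrightarrow> x0) (at p0)" by (simp add: tendsto_dist_iff[of ?x x0])
  then show "isCont ?x (A, b)" by (simp add: isCont_def x0_def p0_def)
qed

section \<open>Derivative formula under the gap between the singular values\<close>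

lemma smallest_sv_nonneg: "0 \<le> smallest_sv X"
  by (metis norm_ge_zero smallest_sv_min)

lemma matrix_inv_mult_vector:
  fixes M :: "real^'n^'n"
  assumes "\<And>v. M *v v = 0 \<Longrightarrow> v = 0"
  shows "matrix_inv M *v (M *v v) = v"
proof -
  have "invertible M"
    using assms unfolding invertible_left_inverse matrix_left_invertible_ker by blast
  then have "matrix_inv M ** M = mat 1"
    unfolding invertible_def matrix_inv_def by (rule someI2_ex) blast
  then show ?thesis by (simp add: matrix_vector_mul_assoc)
qed

text \<open>The objective values are the squared stretches of \<open>[A, b]\<close> along the
  vectors \<open>(-y, 1)\<close>. The minimal stretch is among them, since a minimal singular vector
  with last entry 0 would make \<open>A\<close> stretch a unit vector by less than
  \<open>smallest_sv A\<close>.\<close>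

lemma tls_obj_below_smallest_sv:
  fixes A :: "real^'n^'m"
  assumes lt: "smallest_sv (augment A b) < smallest_sv A"
  obtains x1 where "tls_obj A b x1 = (smallest_sv (augment A b))\<^sup>2"
    "\<And>y. (smallest_sv (augment A b))\<^sup>2 \<le> tls_obj A b y"
proof -
  define \<tau> where "\<tau> = smallest_sv (augment A b)"
  obtain z where z: "norm z = 1" "norm (augment A b *v z) = \<tau>"
    "\<And>w. \<tau> * norm w \<le> norm (augment A b *v w)"
    using smallest_sv_min[of "augment A b"] unfolding \<tau>_def by blast
  obtain u w where uw: "z = vjoin u w" by (rule vjoin_surj)
  define t where "t = w $ 1"
  have w2: "(norm w)\<^sup>2 = t\<^sup>2" by (simp add: power2_norm_vec UNIV_1 t_def)
  have ut: "(norm u)\<^sup>2 + t\<^sup>2 = 1" using z(1) power2_norm_vjoin[of u w] by (simp add: uw w2)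
  have res: "norm (A *v u + t *\<^sub>R b) = \<tau>" using z(2) by (simp add: uw augment_vjoin_mult t_def)
  obtain A_min: "\<And>v. smallest_sv A * norm v \<le> norm (A *v v)" using smallest_sv_min[of A] by blast
  have "t \<noteq> 0"
  proof
    assume "t = 0"
    then have "norm u = 1" using ut by (simp add: power2_eq_1_iff) (smt (verit) norm_ge_zero)
    with A_min[of u] res lt show False by (simp add: \<open>t = 0\<close> \<tau>_def)
  qed
  \<comment> \<open>Scaling the singular vector \<open>(u, t)\<close> to last entry 1 gives
    \<open>(u / t, 1)\<close>, so the candidate is \<open>- (u / t)\<close>.\<close>
  have "b - A *v (- (u /\<^sub>R t)) = (A *v u + t *\<^sub>R b) /\<^sub>R t"
    using \<open>t \<noteq> 0\<close> by (simp add: matrix_vector_mult_scaleR scaleR_right_distrib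
        bounded_bilinear.minus_right[OF bounded_bilinear_matrix_vector_mult])
  then have "(norm (b - A *v (- (u /\<^sub>R t))))\<^sup>2 = \<tau>\<^sup>2 / t\<^sup>2"
    by (simp add: res power_mult_distrib power_inverse divide_inverse mult.commute)
  moreover have "1 + (norm (- (u /\<^sub>R t)))\<^sup>2 = 1 / t\<^sup>2"
    using \<open>t \<noteq> 0\<close> ut by (simp add: power_mult_distrib field_simps)
  ultimately have 1: "tls_obj A b (- (u /\<^sub>R t)) = \<tau>\<^sup>2"
    using \<open>t \<noteq> 0\<close> by (simp add: tls_obj_def)
  have 2: "\<tau>\<^sup>2 \<le> tls_obj A b y" for y
  proof -
    define v where "v = vjoin (- y) ((\<chi> _. 1) :: real^1)"
    have "(norm v)\<^sup>2 = 1 + (norm y)\<^sup>2"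
      by (simp add: v_def power2_norm_vjoin power2_norm_vec[of "(\<chi> _. 1) :: real^1"] UNIV_1)
    moreover have "augment A b *v v = b - A *v y"
      by (simp add: v_def augment_vjoin_mult bounded_bilinear.minus_right[OF bounded_bilinear_matrix_vector_mult])
    ultimately have "\<tau>\<^sup>2 * (1 + (norm y)\<^sup>2) \<le> (norm (b - A *v y))\<^sup>2"
      using power_mono[OF z(3)[of v], of 2] smallest_sv_nonneg[of "augment A b"]
      by (simp add: power_mult_distrib \<tau>_def)
    then show ?thesis using one_plus_norm_pos[of y] by (simp add: tls_obj_def pos_le_divide_eq)
  qed
  show ?thesis using 1 2 that unfolding \<tau>_def by blast
qed

text \<open>At the minimal value \<open>\<tau>\<^sup>2\<close>, stationarity reads
  \<open>M x = A^T b\<close>, which identifies the solution with the closed formula; implicit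
  differentiation then has \<open>-M\<close> to invert.\<close>

lemma tls_deriv_eq:
  fixes A :: "real^'n^'m" and b :: "real^'m" and L :: "real^'k^'n"
  assumes \<tau>: "\<tau> = smallest_sv (augment A b)" and lt: "\<tau> < smallest_sv A"
    and M: "M = transpose A ** A - \<tau>\<^sup>2 *\<^sub>R mat 1"
    and x: "x = matrix_inv M *v (transpose A *v b)" and r: "r = b - A *v x"
  shows "tls_deriv L A b (\<Delta>A, \<Delta>b) = transpose L *v (matrix_inv M *v
    (r v* \<Delta>A + (\<Delta>b - \<Delta>A *v x) v* A
      + (2 * (r \<bullet> (\<Delta>b - \<Delta>A *v x)) / (1 + (norm x)\<^sup>2)) *\<^sub>R x))"
proof -
  define s where "s = smallest_sv A"
  define h where "h = (\<lambda>p :: (real^'n^'m) \<times> (real^'m). tls_solution (fst p) (snd p))"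
  have s: "0 \<le> s" "\<And>v. s * norm v \<le> norm (A *v v)"
    using smallest_sv_nonneg smallest_sv_min[of A] unfolding s_def by blast+
  obtain x1 where x1: "tls_obj A b x1 = \<tau>\<^sup>2" and ge: "\<And>y. \<tau>\<^sup>2 \<le> tls_obj A b y"
    using tls_obj_below_smallest_sv[of A b] lt unfolding \<tau> by blast
  have \<tau>s: "\<tau>\<^sup>2 < s\<^sup>2"
    using lt smallest_sv_nonneg[of "augment A b"] unfolding s_def \<tau> by (intro power_strict_mono) auto
  then have x1': "tls_obj A b x1 < s\<^sup>2" using x1 by simp
  note min = tls_solution_minimizer[OF s x1']
  have obj: "tls_obj A b (h (A, b)) = \<tau>\<^sup>2"
    using min(1)[of x1] ge[of "h (A, b)"] x1 by (simp add: h_def)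
  have Mv: "M *v v = (A *v v) v* A - \<tau>\<^sup>2 *\<^sub>R v" for v
    by (simp add: M matrix_vector_mult_diff_rdistrib scaleR_matrix_vector_assoc[symmetric]
        matrix_vector_mul_assoc[symmetric] del: matrix_vector_mul_assoc)
  have inv: "matrix_inv M *v (M *v v) = v" for v
  proof (rule matrix_inv_mult_vector)
    \<comment> \<open>A nonzero kernel vector would be stretched by \<open>A\<close> by exactly the
      factor \<open>\<tau>\<close>, below the minimal stretch \<open>s\<close>.\<close>
    fix v assume "M *v v = 0"
    then have "0 = ((A *v v) v* A) \<bullet> v - \<tau>\<^sup>2 * (v \<bullet> v)"
      unfolding Mv by (metis inner_diff_left inner_scaleR_left inner_zero_left)
    then have "(norm (A *v v))\<^sup>2 = \<tau>\<^sup>2 * (norm v)\<^sup>2"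
      by (simp add: dot_lmul_matrix power2_norm_eq_inner)
    moreover have "(s * norm v)\<^sup>2 \<le> (norm (A *v v))\<^sup>2" using s by (intro power_mono) auto
    ultimately have "(s\<^sup>2 - \<tau>\<^sup>2) * (norm v)\<^sup>2 \<le> 0" by (simp add: power_mult_distrib left_diff_distrib)
    with \<tau>s show "v = 0" by (simp add: mult_le_0_iff)
  qed
  have zero: "tls_stationarity ((A, b), h (A, b)) = 0"
    using tls_obj_minimizer_stationary(1)[OF min(1)] by (simp add: tls_stationarity_def h_def)
  then have "M *v h (A, b) = transpose A *v b"
    by (simp add: tls_stationarity_def obj Mv algebra_simps
        bounded_bilinear.diff_left[OF bounded_bilinear_vector_matrix_mult])
  then have hx: "h (A, b) = x" using inv[of "h (A, b)"] by (simp add: x)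
  define P where "P = (\<lambda>u. r v* fst u + (snd u - fst u *v x) v* A
        + (2 * (r \<bullet> (snd u - fst u *v x)) / (1 + (norm x)\<^sup>2)) *\<^sub>R x)"
  define Q where "Q = (\<lambda>v. \<tau>\<^sup>2 *\<^sub>R v - (A *v v) v* A)"
  have G: "(tls_stationarity has_derivative (\<lambda>(u, v). P u + Q v)) (at ((A, b), h (A, b)))"
    using has_derivative_tls_stationarity[OF zero] obj unfolding hx P_def Q_def r by simp
  \<comment> \<open>\<open>P\<close> is the total derivative restricted to \<open>v = 0\<close>,
    where \<open>Q\<close> vanishes, and so inherits boundedness.\<close>
  have "bounded_linear (\<lambda>u. case (u, 0) of (u, v) \<Rightarrow> P u + Q v)"
    by (rule bounded_linear_compose[OF has_derivative_bounded_linear[OF G]])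
       (intro bounded_linear_Pair bounded_linear_ident bounded_linear_zero)
  then have P: "bounded_linear P" by (simp add: Q_def)
  have "(h has_derivative (\<lambda>u. - (- (matrix_inv M *v P u)))) (at (A, b))"
  proof (rule has_derivative_implicit[where h = h and a = "(A, b)" and
        R = "\<lambda>z. - (matrix_inv M *v z)", OF G P])
    show "bounded_linear (\<lambda>z. - (matrix_inv M *v z))"
      by (intro bounded_linear_minus matrix_vector_mul_bounded_linear)
    show "- (matrix_inv M *v Q v) = v" for v
    proof -
      have "Q v = - (M *v v)" by (simp add: Q_def Mv)
      then show ?thesis
        by (simp only: bounded_bilinear.minus_right[OF bounded_bilinear_matrix_vector_mult] inv minus_minus)
    qed
    show "isCont h (A, b)" "\<forall>\<^sub>F p in nhds (A, b). tls_stationarity (p, h p) = 0"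
      using tls_solution_continuous_stationary[OF s x1'] by (simp_all add: h_def)
  qed
  then have "((\<lambda>p. transpose L *v h p) has_derivative (\<lambda>u. transpose L *v (matrix_inv M *v P u))) (at (A, b))"
    using bounded_linear.has_derivative[OF matrix_vector_mul_bounded_linear[of "transpose L"]]
    by (simp only: minus_minus)
  moreover have "tls_g L = (\<lambda>p. transpose L *v h p)"
    by (simp add: tls_g_def h_def fun_eq_iff)
  ultimately have "tls_deriv L A b = (\<lambda>u. transpose L *v (matrix_inv M *v P u))"
    unfolding tls_deriv_def by (simp only: frechet_derivative_at[symmetric])
  then show ?thesis by (simp add: P_def)
qed

section \<open>The derivative as a matrix acting on vectorised data\<close>

lemma hjoin_mult_vec_pair: "hjoin X Y *v vec_pair Z v = X *v vectorize Z + Y *v v"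
  by (simp add: vec_eq_iff hjoin_def vec_pair_def vjoin_def matrix_vector_mult_def sum_UNIV_Plus)

text \<open>The identity \<open>vec(Y Z X) = (X^T \<otimes> Y) vec Z\<close> for a single column
  \<open>X = v\<close>.\<close>

lemma kron_row_mult_vectorize: "kron_row v Y *v vectorize Z = Y *v (Z *v v)"
proof -
  have "(kron_row v Y *v vectorize Z) $ i = (\<Sum>p\<in>UNIV \<times> UNIV. v $ fst p * Y $ i $ snd p * Z $ snd p $ fst p)" for i
    by (simp add: matrix_vector_mult_def kron_row_def kron_def vectorize_def rowvector_def)
  also have "\<dots> i = (\<Sum>d\<in>UNIV. \<Sum>c\<in>UNIV. v $ c * Y $ i $ d * Z $ d $ c)" for i
    by (subst sum.swap) (simp only: sum.cartesian_product case_prod_unfold)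
  finally show ?thesis
    by (simp add: vec_eq_iff matrix_vector_mult_def sum_distrib_left mult_ac)
qed

text \<open>The transpose of \<open>\<Delta>A\<close> applied to \<open>r\<close> gives the permuted
  Kronecker block. All else depends on \<open>\<Delta>b - \<Delta>A x\<close>, to which
  \<open>D\<close> is applied; hence \<open>-x^T \<otimes> D\<close> beside
  \<open>D\<close>.\<close>

lemma tls_deriv_eq_matrix_mult:
  fixes A :: "real^'n^'m" and b :: "real^'m" and L :: "real^'k^'n"
  assumes \<tau>: "\<tau> = smallest_sv (augment A b)" and lt: "\<tau> < smallest_sv A"
    and M: "M = transpose A ** A - \<tau>\<^sup>2 *\<^sub>R mat 1"
    and x: "x = matrix_inv M *v (transpose A *v b)" and r: "r = b - A *v x"
    and D: "D = transpose L ** matrix_inv M **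
           (transpose A + (2 / (1 + (norm x)\<^sup>2)) *\<^sub>R
              ((columnvector x :: real^1^'n) ** (rowvector r :: real^'m^1)))"
  shows "tls_deriv L A b (\<Delta>A, \<Delta>b) =
    hjoin (kron_row r (transpose L ** matrix_inv M) ** vec_perm - kron_row x D) D *v vec_pair \<Delta>A \<Delta>b"
proof -
  have outer: "(columnvector x :: real^1^'n) *v ((rowvector r :: real^'m^1) *v v) = (r \<bullet> v) *\<^sub>R x" for v
    by (simp add: vec_eq_iff matrix_vector_mult_def matrix_matrix_mult_def columnvector_def
        rowvector_def UNIV_1 inner_vec_def sum_distrib_left sum_distrib_right mult_ac)
  have D_mult: "D *v v = transpose L *v (matrix_inv M *v (v v* A + (2 * (r \<bullet> v) / (1 + (norm x)\<^sup>2)) *\<^sub>R x))" for v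
    unfolding D matrix_vector_mul_assoc[symmetric] matrix_vector_mult_add_rdistrib
      scaleR_matrix_vector_assoc[symmetric] outer by simp
  have "hjoin (kron_row r (transpose L ** matrix_inv M) ** vec_perm - kron_row x D) D *v vec_pair \<Delta>A \<Delta>b =
      transpose L *v (matrix_inv M *v (r v* \<Delta>A)) + D *v (\<Delta>b - \<Delta>A *v x)"
    unfolding hjoin_mult_vec_pair matrix_vector_mult_diff_rdistrib matrix_vector_mul_assoc[symmetric]
      vec_perm_vectorize kron_row_mult_vectorize matrix_vector_mult_diff_distrib
    by simp
  then show ?thesis
    unfolding tls_deriv_eq[OF \<tau> lt M x r] D_mult matrix_vector_right_distrib by simp
qed

subsection \<open>Condition numbers as operator norms\<close>

lemma is_norm_le_norm:
  assumes "is_norm \<nu>"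
  obtains C where "0 < C" "\<And>z. \<nu> z \<le> C * norm z"
proof
  let ?C = "1 + (\<Sum>i\<in>UNIV. \<nu> (axis i 1))"
  have nn: "0 \<le> \<nu> z" for z using assms by (simp add: is_norm_def)
  then show "0 < ?C" by (simp add: add_pos_nonneg sum_nonneg)
  fix z
  have sum: "\<nu> (\<Sum>i\<in>S. f i) \<le> (\<Sum>i\<in>S. \<nu> (f i))" if "finite S" for S and f :: "'a \<Rightarrow> real^'a"
    using that
  proof induction
    case empty
    have "\<nu> 0 = 0" using assms unfolding is_norm_def by blast
    then show ?case by simp
  next
    case (insert i S)
    have "\<nu> (f i + sum f S) \<le> \<nu> (f i) + \<nu> (sum f S)" using assms by (simp add: is_norm_def)
    with insert show ?case by simp
  qed
  have "\<nu> z = \<nu> (\<Sum>i\<in>UNIV. z $ i *\<^sub>R axis i 1)"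
    by (simp add: basis_expansion[of z, unfolded scalar_mult_eq_scaleR])
  also have "\<dots> \<le> (\<Sum>i\<in>UNIV. \<nu> (z $ i *\<^sub>R axis i 1))" by (rule sum) simp
  also have "\<dots> = (\<Sum>i\<in>UNIV. \<bar>z $ i\<bar> * \<nu> (axis i 1))" using assms by (simp add: is_norm_def)
  also have "\<dots> \<le> (\<Sum>i\<in>UNIV. norm z * \<nu> (axis i 1))"
    by (intro sum_mono mult_right_mono nn component_le_norm_cart)
  also have "\<dots> \<le> ?C * norm z" by (simp add: sum_distrib_left[symmetric] algebra_simps)
  finally show "\<nu> z \<le> ?C * norm z" .
qed

text \<open>The upper bound makes \<open>\<mu>\<close> Lipschitz, hence continuous; its minimum on
  the compact unit sphere is positive by definiteness.\<close>

lemma is_norm_ge_norm: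
  assumes "is_norm \<mu>"
  obtains c where "0 < c" "\<And>z. c * norm z \<le> \<mu> z"
proof -
  obtain C where C: "0 < C" "\<And>z. \<mu> z \<le> C * norm z"
    using is_norm_le_norm[OF assms] by blast
  have tri: "\<mu> x - \<mu> y \<le> \<mu> (x - y)" for x y
  proof -
    have "\<mu> ((x - y) + y) \<le> \<mu> (x - y) + \<mu> y" using assms unfolding is_norm_def by blast
    then show ?thesis by simp
  qed
  have lip: "\<bar>\<mu> x - \<mu> y\<bar> \<le> C * dist x y" for x y
  proof -
    have "\<mu> x - \<mu> y \<le> C * dist x y" using tri[of x y] C(2)[of "x - y"] by (simp add: dist_norm)
    moreover have "\<mu> y - \<mu> x \<le> C * dist x y"
      using tri[of y x] C(2)[of "y - x"] by (simp add: dist_norm norm_minus_commute)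
    ultimately show ?thesis by linarith
  qed
  have "C-lipschitz_on (sphere 0 1) \<mu>"
    using lip C(1) by (intro lipschitz_onI) (auto simp: dist_real_def)
  then have "continuous_on (sphere 0 1) \<mu>" by (rule lipschitz_on_continuous_on)
  moreover have "sphere (0::real^'a) 1 \<noteq> {}" by simp
  ultimately obtain v where v: "v \<in> sphere 0 1" "\<And>u. u \<in> sphere 0 1 \<Longrightarrow> \<mu> v \<le> \<mu> u"
    using continuous_attains_inf[OF compact_sphere] by metis
  show ?thesis
  proof
    have "v \<noteq> 0" using v(1) by auto
    then have "\<mu> v \<noteq> 0" using assms unfolding is_norm_def by blast
    then show "0 < \<mu> v" using assms by (simp add: is_norm_def less_le)
    fix z
    show "\<mu> v * norm z \<le> \<mu> z"
    proof (cases "z = 0")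
      case False
      then have "\<mu> v \<le> \<mu> (z /\<^sub>R norm z)" by (intro v(2)) simp
      also have "\<dots> = \<mu> z / norm z"
        using assms by (simp add: is_norm_def divide_inverse_commute)
      finally show ?thesis using False by (simp add: field_simps)
    qed (use assms in \<open>simp add: is_norm_def\<close>)
  qed
qed

text \<open>A real supremum is meaningful only for a bounded set; equivalence of norms in finite
  dimension provides the bound.\<close>

lemma is_norm_quotient_bdd_above:
  assumes "is_norm \<mu>" "is_norm \<nu>"
  shows "bdd_above ((\<lambda>y. \<nu> (N *v y) / \<mu> y) ` {y. y \<noteq> 0})"
proof -
  obtain C where C: "0 < C" "\<And>z. \<nu> z \<le> C * norm z"
    using is_norm_le_norm[OF assms(2)] by blast
  obtain c where c: "0 < c" "\<And>z. c * norm z \<le> \<mu> z"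
    using is_norm_ge_norm[OF assms(1)] by blast
  have "\<nu> (N *v y) / \<mu> y \<le> C * norm N / c" if "y \<noteq> 0" for y
  proof -
    have "\<nu> (N *v y) \<le> C * (norm N * norm y)"
      using C(2)[of "N *v y"] norm_matrix_vector_mult_le[of N y] C(1)
      by (meson mult_left_mono order_trans less_imp_le)
    then have "\<nu> (N *v y) / \<mu> y \<le> C * (norm N * norm y) / (c * norm y)"
      using that c C(1) by (intro frac_le) auto
    then show ?thesis using that by simp
  qed
  then show ?thesis by (intro bdd_aboveI2[where M = "C * norm N / c"]) auto
qed

text \<open>Compares a real supremum with one in \<open>[0, \<infinity>]\<close>: a finite
  \<open>K\<close> reduces to a real bound, an infinite one is trivial.\<close>

lemma ennreal_cSUP_le:
  assumes "S \<noteq> {}" "\<And>y. y \<in> S \<Longrightarrow> 0 \<le> f y" "\<And>y. y \<in> S \<Longrightarrow> ennreal (f y) \<le> K"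
  shows "ennreal (SUP y\<in>S. f y) \<le> K"
proof (cases K)
  case (real k)
  then have "f y \<le> k" if "y \<in> S" for y using assms(3)[OF that] by simp
  then have "(SUP y\<in>S. f y) \<le> k" using assms(1) by (intro cSUP_least)
  then show ?thesis using real by simp
qed simp

text \<open>Erasing entries averages a vector with one of its sign changes.\<close>

lemma is_absolute_erase_le:
  assumes "is_norm \<mu>" "is_absolute \<mu>" and erase: "\<And>i. y' $ i = y $ i \<or> y' $ i = 0"
  shows "\<mu> y' \<le> \<mu> y"
proof -
  define z where "z = 2 *\<^sub>R y' - y"
  have "\<bar>z $ i\<bar> = \<bar>y $ i\<bar>" for i using erase[of i] by (auto simp: z_def)
  then have "\<mu> z = \<mu> y" using assms(2) unfolding is_absolute_def by blast
  moreover have 2: "2 *\<^sub>R y' = y + z" by (simp add: z_def)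
  have "2 * \<mu> y' \<le> \<mu> y + \<mu> z"
  proof -
    have "\<mu> (2 *\<^sub>R y') = \<bar>2\<bar> * \<mu> y'" "\<mu> (y + z) \<le> \<mu> y + \<mu> z"
      using assms(1) unfolding is_norm_def by blast+
    then show ?thesis by (simp add: 2)
  qed
  ultimately show ?thesis by simp
qed

section \<open>Rescaling the perturbations\<close>

lemma diag_mult_nth: "(diag w *v y) $ i = w $ i * y $ i"
  by (simp add: diag_def matrix_vector_mult_def if_distrib[of "\<lambda>c. c * _"] cong: if_cong)

lemma vec_pair_nth:
  "vec_pair X v $ Inl (j, i) = X $ i $ j" "vec_pair X v $ Inr i = v $ i"
  by (simp_all add: vec_pair_def vjoin_def vectorize_def)

text \<open>An admissible perturbation is \<open>diag w\<close> applied to its rescaled vector,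
  which gives one inequality. Conversely, the restriction of any \<open>y\<close> to the support of
  \<open>w\<close> is the rescaled vector of an admissible perturbation.\<close>

lemma kappa_tls_eq_induced_norm:
  fixes J :: "real^(('n::finite \<times> 'm::finite) + 'm)^'k"
  assumes deriv: "\<And>\<Delta>A \<Delta>b. tls_deriv L A b (\<Delta>A, \<Delta>b) = J *v vec_pair \<Delta>A \<Delta>b"
    and \<mu>: "is_norm \<mu>" and \<nu>: "is_norm \<nu>"
    and abs: "is_absolute \<mu> \<or> (\<forall>i j. \<Psi> $ i $ j \<noteq> 0) \<and> (\<forall>i. \<beta> $ i \<noteq> 0)"
  shows "kappa_tls \<mu> \<nu> \<Psi> \<beta> \<xi> L A b =
    ennreal (induced_norm \<mu> \<nu> (diag_ddag \<xi> ** J ** diag (vec_pair \<Psi> \<beta>)))"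
proof (rule antisym)
  define w where "w = vec_pair \<Psi> \<beta>"
  define N where "N = diag_ddag \<xi> ** J ** diag w"
  have N: "vdiv (tls_deriv L A b (\<Delta>A, \<Delta>b)) \<xi> = N *v y"
    if "diag w *v y = vec_pair \<Delta>A \<Delta>b" for \<Delta>A \<Delta>b y
    unfolding N_def matrix_vector_mul_assoc[symmetric] that by (simp add: vdiv_def deriv)
  have nonneg: "0 \<le> \<mu> y" "0 \<le> \<nu> z" for y z using \<mu> \<nu> by (simp_all add: is_norm_def)
  have zero: "\<mu> y = 0 \<longleftrightarrow> y = 0" "\<nu> z = 0 \<longleftrightarrow> z = 0" for y z using \<mu> \<nu> by (simp_all add: is_norm_def)
  show "kappa_tls \<mu> \<nu> \<Psi> \<beta> \<xi> L A b \<le> ennreal (induced_norm \<mu> \<nu> (diag_ddag \<xi> ** J ** diag (vec_pair \<Psi> \<beta>)))"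
    unfolding kappa_tls_def induced_norm_def w_def[symmetric] N_def[symmetric]
  proof (rule SUP_least, clarify)
    fix \<Delta>A :: "real^'n^'m" and \<Delta>b :: "real^'m"
    assume adm: "\<forall>i j. \<Psi> $ i $ j = 0 \<longrightarrow> \<Delta>A $ i $ j = 0" "\<forall>i. \<beta> $ i = 0 \<longrightarrow> \<Delta>b $ i = 0"
      and "\<mu> (vec_pair (mdiv \<Delta>A \<Psi>) (vdiv \<Delta>b \<beta>)) \<noteq> 0"
    define y where "y = vec_pair (mdiv \<Delta>A \<Psi>) (vdiv \<Delta>b \<beta>)"
    have y0: "y \<noteq> 0" using \<open>\<mu> _ \<noteq> 0\<close> zero by (auto simp: y_def)
    \<comment> \<open>Where a parameter vanishes, the left side is 0 through \<open>w\<close> and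
      the right side by admissibility; elsewhere \<open>ddag\<close> is the reciprocal.\<close>
    have "(diag w *v y) $ s = vec_pair \<Delta>A \<Delta>b $ s" for s
      using adm by (cases s) (auto simp: diag_mult_nth w_def y_def vec_pair_nth mdiv_def vdiv_def
          diag_ddag_def ddag_def)
    then have "diag w *v y = vec_pair \<Delta>A \<Delta>b" by (simp add: vec_eq_iff)
    from N[OF this] have "\<nu> (vdiv (tls_deriv L A b (\<Delta>A, \<Delta>b)) \<xi>) / \<mu> y = \<nu> (N *v y) / \<mu> y" by simp
    also have "\<dots> \<le> (SUP y\<in>{y. y \<noteq> 0}. \<nu> (N *v y) / \<mu> y)"
      using y0 by (intro cSUP_upper is_norm_quotient_bdd_above \<mu> \<nu>) simp
    finally show "ennreal (\<nu> (vdiv (tls_deriv L A b (\<Delta>A, \<Delta>b)) \<xi>) / \<mu> (vec_pair (mdiv \<Delta>A \<Psi>) (vdiv \<Delta>b \<beta>)))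
        \<le> ennreal (SUP y\<in>{y. y \<noteq> 0}. \<nu> (N *v y) / \<mu> y)"
      by (simp only: y_def ennreal_leI)
  qed
  show "ennreal (induced_norm \<mu> \<nu> (diag_ddag \<xi> ** J ** diag (vec_pair \<Psi> \<beta>))) \<le> kappa_tls \<mu> \<nu> \<Psi> \<beta> \<xi> L A b"
    unfolding induced_norm_def w_def[symmetric] N_def[symmetric]
  proof (rule ennreal_cSUP_le)
    have "axis undefined 1 \<in> {y::real^(('n \<times> 'm) + 'm). y \<noteq> 0}" by (simp add: axis_eq_0_iff)
    then show "{y::real^(('n \<times> 'm) + 'm). y \<noteq> 0} \<noteq> {}" by blast
    show "0 \<le> \<nu> (N *v y) / \<mu> y" for y using nonneg by simp
    fix y :: "real^(('n \<times> 'm) + 'm)" assume "y \<in> {y. y \<noteq> 0}"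
    then have y0: "y \<noteq> 0" by simp
    \<comment> \<open>\<open>N\<close> ignores the entries at zeros of \<open>w\<close>, but
      \<open>\<mu>\<close> counts them; erasing them keeps \<open>N *v y\<close> and does not
      enlarge the norm.\<close>
    define y' where "y' = (\<chi> s. if w $ s = 0 then 0 else y $ s)"
    have wy: "diag w *v y' = diag w *v y" by (simp add: vec_eq_iff diag_mult_nth y'_def)
    then have Ny: "N *v y = N *v y'" by (simp add: N_def matrix_vector_mul_assoc[symmetric] del: matrix_vector_mul_assoc)
    \<comment> \<open>If nothing survives the erasure, the quotient is 0 and no perturbation has to
      match it.\<close>
    show "ennreal (\<nu> (N *v y) / \<mu> y) \<le> kappa_tls \<mu> \<nu> \<Psi> \<beta> \<xi> L A b"
    proof (cases "y' = 0")
      case True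
      then have "\<nu> (N *v y) = 0" using zero by (simp add: Ny)
      then show ?thesis by simp
    next
      case False
      have "\<mu> y' \<le> \<mu> y"
        using abs
      proof
        assume "is_absolute \<mu>"
        then show ?thesis by (intro is_absolute_erase_le \<mu>) (auto simp: y'_def)
      next
        assume nz: "(\<forall>i j. \<Psi> $ i $ j \<noteq> 0) \<and> (\<forall>i. \<beta> $ i \<noteq> 0)"
        have "w $ s \<noteq> 0" for s using nz by (cases s) (auto simp: w_def vec_pair_nth)
        then show ?thesis by (simp add: y'_def)
      qed
      then have le: "\<nu> (N *v y) / \<mu> y \<le> \<nu> (N *v y') / \<mu> y'"
        unfolding Ny using False nonneg zero(1)[of y'] by (intro divide_left_mono) (auto simp: less_le y0 zero)
      \<comment> \<open>Undoes the rescaling. Dividing back yields \<open>y'\<close> instead of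
        \<open>y\<close>: an entry with zero parameter becomes 0, and \<open>ddag 0 = 1\<close>
        keeps it so.\<close>
      define \<Delta>A :: "real^'n^'m" where "\<Delta>A = (\<chi> i j. \<Psi> $ i $ j * y $ Inl (j, i))"
      define \<Delta>b where "\<Delta>b = (\<chi> i. \<beta> $ i * y $ Inr i)"
      have "vec_pair (mdiv \<Delta>A \<Psi>) (vdiv \<Delta>b \<beta>) $ s = y' $ s" for s
        by (cases s) (auto simp: y'_def w_def vec_pair_nth mdiv_def vdiv_def diag_ddag_def
            diag_mult_nth ddag_def \<Delta>A_def \<Delta>b_def)
      then have y'eq: "vec_pair (mdiv \<Delta>A \<Psi>) (vdiv \<Delta>b \<beta>) = y'" by (simp add: vec_eq_iff)
      have "(diag w *v y') $ s = vec_pair \<Delta>A \<Delta>b $ s" for s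
        unfolding wy by (cases s) (auto simp: w_def vec_pair_nth diag_mult_nth \<Delta>A_def \<Delta>b_def)
      then have "diag w *v y' = vec_pair \<Delta>A \<Delta>b" by (simp add: vec_eq_iff)
      note NN = N[OF this]
      have adm: "\<forall>i j. \<Psi> $ i $ j = 0 \<longrightarrow> \<Delta>A $ i $ j = 0" "\<forall>i. \<beta> $ i = 0 \<longrightarrow> \<Delta>b $ i = 0"
        by (simp_all add: \<Delta>A_def \<Delta>b_def)
      show ?thesis
        unfolding kappa_tls_def
      proof (rule SUP_upper2[of "(\<Delta>A, \<Delta>b)"])
        show "ennreal (\<nu> (N *v y) / \<mu> y) \<le> (case (\<Delta>A, \<Delta>b) of (\<Delta>A, \<Delta>b) \<Rightarrow>
          ennreal (\<nu> (vdiv (tls_deriv L A b (\<Delta>A, \<Delta>b)) \<xi>) / \<mu> (vec_pair (mdiv \<Delta>A \<Psi>) (vdiv \<Delta>b \<beta>))))"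
          using le by (simp add: NN y'eq ennreal_leI)
      qed (use False adm in \<open>simp add: y'eq zero\<close>)
    qed
  qed
qed

text \<open>Positive parameters make the rescaling a bijection; \<open>\<psi>\<close> and
  \<open>\<beta>\<close> are absorbed in \<open>J'\<close>, and \<open>1 / \<xi>\<close> factors out
  of the supremum.\<close>

lemma kappa2_tls_eq_onorm:
  fixes J J' :: "real^(('n::finite \<times> 'm::finite) + 'm)^'k"
  assumes deriv: "\<And>\<Delta>A \<Delta>b. tls_deriv L A b (\<Delta>A, \<Delta>b) = J *v vec_pair \<Delta>A \<Delta>b"
    and J': "\<And>\<Delta>A \<Delta>b. J *v vec_pair (\<psi> *\<^sub>R \<Delta>A) (\<beta> *\<^sub>R \<Delta>b) = J' *v vec_pair \<Delta>A \<Delta>b"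
    and pos: "0 < \<psi>" "0 < \<beta>" "0 < \<xi>"
  shows "kappa2_tls \<psi> \<beta> \<xi> L A b = ennreal (onorm ((*v) J') / \<xi>)"
proof (rule antisym)
  have N: "norm (tls_deriv L A b (\<Delta>A, \<Delta>b) /\<^sub>R \<xi>) = norm (J' *v vec_pair (\<Delta>A /\<^sub>R \<psi>) (\<Delta>b /\<^sub>R \<beta>)) / \<xi>"
    for \<Delta>A \<Delta>b using pos by (simp add: deriv J'[symmetric] divide_inverse_commute)
  show "kappa2_tls \<psi> \<beta> \<xi> L A b \<le> ennreal (onorm ((*v) J') / \<xi>)"
    unfolding kappa2_tls_def
  proof (rule SUP_least, clarify)
    fix \<Delta>A :: "real^'n^'m" and \<Delta>b :: "real^'m"
    define y where "y = vec_pair (\<Delta>A /\<^sub>R \<psi>) (\<Delta>b /\<^sub>R \<beta>)"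
    have "norm (J' *v y) / norm y / \<xi> \<le> onorm ((*v) J') / \<xi>"
      using pos by (intro divide_right_mono le_onorm matrix_vector_mul_bounded_linear) simp
    then show "ennreal (norm (tls_deriv L A b (\<Delta>A, \<Delta>b) /\<^sub>R \<xi>) / norm (vec_pair (\<Delta>A /\<^sub>R \<psi>) (\<Delta>b /\<^sub>R \<beta>)))
        \<le> ennreal (onorm ((*v) J') / \<xi>)"
      unfolding N y_def[symmetric] by (intro ennreal_leI) (simp add: mult.commute)
  qed
  have "ennreal (SUP y. norm (J' *v y) / norm y / \<xi>) \<le> kappa2_tls \<psi> \<beta> \<xi> L A b"
  proof (rule ennreal_cSUP_le)
    show "0 \<le> norm (J' *v y) / norm y / \<xi>" for y using pos by simp
    fix y
    \<comment> \<open>The supremum in \<open>onorm\<close> includes \<open>y = 0\<close>, where the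
      quotient is 0 by the convention for division by zero.\<close>
    show "ennreal (norm (J' *v y) / norm y / \<xi>) \<le> kappa2_tls \<psi> \<beta> \<xi> L A b"
    proof (cases "y = 0")
      case False
      define \<Delta>A :: "real^'n^'m" where "\<Delta>A = (\<chi> i j. \<psi> * y $ Inl (j, i))"
      define \<Delta>b where "\<Delta>b = (\<chi> i. \<beta> * y $ Inr i)"
      have "vec_pair (\<Delta>A /\<^sub>R \<psi>) (\<Delta>b /\<^sub>R \<beta>) $ s = y $ s" for s
        using pos by (cases s) (auto simp: vec_pair_nth \<Delta>A_def \<Delta>b_def)
      then have y: "vec_pair (\<Delta>A /\<^sub>R \<psi>) (\<Delta>b /\<^sub>R \<beta>) = y" by (simp add: vec_eq_iff)
      show ?thesis
        unfolding kappa2_tls_def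
        by (rule SUP_upper2[of "(\<Delta>A, \<Delta>b)"]) (use False in \<open>simp_all add: N y mult.commute del: norm_scaleR\<close>)
    qed simp
  qed simp
  moreover have "onorm ((*v) J') / \<xi> \<le> (SUP y. norm (J' *v y) / norm y / \<xi>)"
  proof -
    have bdd: "bdd_above (range (\<lambda>y. norm (J' *v y) / norm y / \<xi>))"
      using pos by (intro bdd_aboveI2[where M = "onorm ((*v) J') / \<xi>"] divide_right_mono le_onorm
          matrix_vector_mul_bounded_linear) simp
    have "onorm ((*v) J') \<le> (SUP y. norm (J' *v y) / norm y / \<xi>) * \<xi>"
      unfolding onorm_def
    proof (rule cSUP_least)
      fix y
      have "norm (J' *v y) / norm y / \<xi> \<le> (SUP y. norm (J' *v y) / norm y / \<xi>)"
        using bdd by (rule cSUP_upper[rotated]) simp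
      then show "norm (J' *v y) / norm y \<le> (SUP y. norm (J' *v y) / norm y / \<xi>) * \<xi>"
        using pos by (simp only: pos_divide_le_eq)
    qed simp
    then show ?thesis using pos by (simp only: pos_divide_le_eq)
  qed
  ultimately show "ennreal (onorm ((*v) J') / \<xi>) \<le> kappa2_tls \<psi> \<beta> \<xi> L A b"
    by (meson ennreal_leI order_trans)
qed

theorem mainTheorem6:
  fixes A :: "real^'n^'m" and b :: "real^'m" and L :: "real^'k^'n"
    and \<sigma> \<tau> :: real and M :: "real^'n^'n" and x :: "real^'n" and r :: "real^'m"
    and D :: "real^'m^'k"
  assumes "CARD('n) \<le> CARD('m)" and "CARD('k) \<le> CARD('n)"
    and "\<sigma> = smallest_sv A" and "\<tau> = smallest_sv (augment A b)"
    and "\<tau> < \<sigma>"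
    and "M = transpose A ** A - \<tau>\<^sup>2 *\<^sub>R mat 1"
    and "x = matrix_inv M *v (transpose A *v b)"
    and "r = b - A *v x"
    and "D = transpose L ** matrix_inv M **
           (transpose A + (2 / (1 + (norm x)\<^sup>2)) *\<^sub>R
              ((columnvector x :: real^1^'n) ** (rowvector r :: real^'m^1)))"
  shows "(\<forall>\<mu> \<nu> \<Psi> \<beta> \<xi>.
            is_norm \<mu> \<and> is_norm \<nu> \<and>
            (is_absolute \<mu> \<or> (\<forall>i j. \<Psi> $ i $ j \<noteq> 0) \<and> (\<forall>i. \<beta> $ i \<noteq> 0)) \<longrightarrow>
            kappa_tls \<mu> \<nu> \<Psi> \<beta> \<xi> L A b =
              ennreal (induced_norm \<mu> \<nu>
                (diag_ddag \<xi> **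
                 hjoin (kron_row r (transpose L ** matrix_inv M) ** vec_perm - kron_row x D) D **
                 diag (vec_pair \<Psi> \<beta>)))) \<and>
         (\<forall>\<psi> \<beta> \<xi>. 0 < \<psi> \<and> 0 < \<beta> \<and> 0 < \<xi> \<longrightarrow>
            kappa2_tls \<psi> \<beta> \<xi> L A b =
              ennreal (onorm ((*v)
                (hjoin (\<psi> *\<^sub>R (kron_row r (transpose L ** matrix_inv M) ** vec_perm - kron_row x D))
                       (\<beta> *\<^sub>R D))) / \<xi>))"
proof -
  define K where "K = kron_row r (transpose L ** matrix_inv M) ** vec_perm - kron_row x D"
  have lt: "\<tau> < smallest_sv A" using assms by simp
  have deriv: "tls_deriv L A b (\<Delta>A, \<Delta>b) = hjoin K D *v vec_pair \<Delta>A \<Delta>b" for \<Delta>A \<Delta>b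
    unfolding K_def by (rule tls_deriv_eq_matrix_mult[OF assms(4) lt assms(6-9)])
  have scaled: "hjoin K D *v vec_pair (\<psi> *\<^sub>R \<Delta>A) (\<beta> *\<^sub>R \<Delta>b) =
      hjoin (\<psi> *\<^sub>R K) (\<beta> *\<^sub>R D) *v vec_pair \<Delta>A \<Delta>b" for \<psi> \<beta> \<Delta>A \<Delta>b
  proof -
    have "vectorize (\<psi> *\<^sub>R \<Delta>A) = \<psi> *\<^sub>R vectorize \<Delta>A" by (simp add: vec_eq_iff vectorize_def)
    then show ?thesis
      by (simp add: hjoin_mult_vec_pair matrix_vector_mult_scaleR scaleR_matrix_vector_assoc)
  qed
  show ?thesis
    unfolding K_def[symmetric]
    using kappa_tls_eq_induced_norm[OF deriv] kappa2_tls_eq_onorm[OF deriv scaled] by blast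
qed

end
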